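(* Let $\Bbbk$ be an algebraically closed field, $n\geq1$, $d_1\geq1$, $d_2\geq0$ integers, and let $S=\Bbbk_{dp}[x_1,\ldots,x_n]\subseteq T=\Bbbk_{dp}[x_0,\ldots,x_n]$. Let $W\subseteq S_{\leq d_1}$ be a nonzero linear subspace and let $r=\dim_{\Bbbk}S^*/\operatorname{Ann}(W)$. Then: (i) The cactus rank of $W^{hom,d_2}$ is not greater than $r$. (ii) If $d_2\geq d_1$, then the border cactus rank of $W^{hom,d_2}$ equals $r$. In particular, the cactus rank and the border cactus rank of $W^{hom,d_2}$ are equal.
   Context: Divided powers: $T^*=\Bbbk[\alpha_0,\ldots,\alpha_n]$ and $S^*=\Bbbk[\alpha_1,\ldots,\alpha_n]$ are polynomial rings; $T=\Bbbk_{dp}[x_0,\ldots,x_n]\supseteq S=\Bbbk_{dp}[x_1,\ldots,x_n]$ are their graded dual (divided power) rings, with $\Bbbk$-basis the divided power monomials $x^{[\mathbf v]}$. $T^*$ acts on $T$ (and $S^*$ on $S$) by contraction: $\alpha^{\mathbf u}\lrcorner x^{[\mathbf v]}=x^{[\mathbf v-\mathbf u]}$ if $v_k\geq u_k$ for all $k$, and $0$ otherwise. For a linear form $L=\sum a_ix_i$, $L^{[d]}=\sum_{|\mathbf u|=d}a^{\mathbf u}x^{[\mathbf u]}$. $\operatorname{Ann}(W)=\{\theta\in S^*\mid\theta\lrcorner W=0\}$. Homogenization: $W^{hom,d_2}=\left\{\sum_iF_i\,x_0^{[d_1+d_2-i]}\;\middle|\;\sum_iF_i\in W,\ F_i\in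 S_i\right\}\subseteq T_{d_1+d_2}$. Ranks: let $\mathbb{P}$ denote the space of lines through $0$, and $\nu_d:\mathbb{P}T_1\to\mathbb{P}T_d$, $[L]\mapsto[L^{[d]}]$. The cactus rank of a $k$-dimensional subspace $V\subseteq T_d$ ($k\geq1$) is the least $r\in\mathbb{Z}_{>0}$ such that $\mathbb{P}V\subseteq\langle\nu_d(R)\rangle$ for some zero-dimensional subscheme $R\subseteq\mathbb{P}T_1$ of length $r$ ($\langle\cdot\rangle$ is the projective linear span of a scheme). The Grassmann cactus variety $\kappa_{r,k}(\nu_d(\mathbb{P}T_1))$ is the Zariski closure in $\operatorname{Gr}(k,T_d)$ (the Grassmannian of $k$-dimensional subspaces) of the set of $[V]$ of cactus rank at most $r$. The border cactus rank of $V$ is the least $r\in\mathbb{Z}_{>0}$ with $[V]\in\kappa_{r,k}(\nu_d(\mathbb{P}T_1))$. *)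

theory Defs
  imports
    "HOL-Library.Poly_Mapping"
    "HOL-Library.Extended_Nat"
    "HOL-Computational_Algebra.Polynomial"
    "Jordan_Normal_Form.Determinant"
begin

type_synonym 'v expo = "'v \<Rightarrow>\<^sub>0 nat"

type_synonym ('v, 'k) mpol = "'v expo \<Rightarrow>\<^sub>0 'k"

text \<open>
  Elements of the divided power ring are stored as their coefficient functions with respect to
  the basis of divided power monomials. The multiplication that the type of finitely supported
  functions carries is the one of the polynomial ring, so it may only be used for \<open>T*\<close> and \<open>S*\<close>;
  the multiplication of the divided power ring is \<open>dp_mult\<close> below.
\<close>

type_synonym 'k dpol = "nat expo \<Rightarrow>\<^sub>0 'k"


section \<open>The underlying vector spaces\<close>

definition pm_scale :: "'k::field \<Rightarrow> ('m \<Rightarrow>\<^sub>0 'k) \<Rightarrow> ('m \<Rightarrow>\<^sub>0 'k)" where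
  "pm_scale c p = Poly_Mapping.map ((*) c) p"

lemma lookup_pm_scale [simp]:
  "Poly_Mapping.lookup (pm_scale c p) m = c * Poly_Mapping.lookup p m"
  by (simp add: pm_scale_def Poly_Mapping.map.rep_eq when_def)

global_interpretation pm: vector_space "pm_scale :: 'k::field \<Rightarrow> ('m \<Rightarrow>\<^sub>0 'k) \<Rightarrow> ('m \<Rightarrow>\<^sub>0 'k)"
  by standard (auto intro!: poly_mapping_eqI simp: lookup_add algebra_simps)

text \<open>
  \<open>basis_mod U A B\<close>: the cosets of the elements of \<open>B\<close> are pairwise distinct and form a basis of
  \<open>U/A\<close>. As for the library's dimension function, \<open>quot_dim\<close> is \<open>0\<close> for an infinite-dimensional
  quotient.
\<close>

definition basis_mod :: "('m \<Rightarrow>\<^sub>0 'k::field) set \<Rightarrow> ('m \<Rightarrow>\<^sub>0 'k) set \<Rightarrow> ('m \<Rightarrow>\<^sub>0 'k) set \<Rightarrow> bool" where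
  "basis_mod U A B \<longleftrightarrow>
     B \<subseteq> U \<and>
     (\<forall>C c. finite C \<and> C \<subseteq> B \<and> (\<Sum>b\<in>C. pm_scale (c b) b) \<in> A \<longrightarrow> (\<forall>b\<in>C. c b = 0)) \<and>
     (\<forall>u\<in>U. \<exists>b\<in>pm.span B. u - b \<in> A)"

definition quot_dim :: "('m \<Rightarrow>\<^sub>0 'k::field) set \<Rightarrow> ('m \<Rightarrow>\<^sub>0 'k) set \<Rightarrow> nat" where
  "quot_dim U A = (if \<exists>B. basis_mod U A B then card (SOME B. basis_mod U A B) else 0)"


section \<open>Polynomial rings, divided power rings and contraction\<close>

definition mdeg :: "'v expo \<Rightarrow> nat" where
  "mdeg u = (\<Sum>i\<in>Poly_Mapping.keys u. Poly_Mapping.lookup u i)"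

definition mpol_eval :: "('v \<Rightarrow> 'k::field) \<Rightarrow> ('v, 'k) mpol \<Rightarrow> 'k" where
  "mpol_eval a p = (\<Sum>u\<in>Poly_Mapping.keys p.
     Poly_Mapping.lookup p u * (\<Prod>i\<in>Poly_Mapping.keys u. a i ^ Poly_Mapping.lookup u i))"

text \<open>
  \<open>pol_vars X\<close> is used for \<open>T*\<close> and \<open>T\<close> with \<open>X = {0..n}\<close>, and for \<open>S*\<close> and \<open>S\<close> with \<open>X = {1..n}\<close>.
\<close>

definition pol_vars :: "'v set \<Rightarrow> ('v, 'k::field) mpol set" where
  "pol_vars X = {p. \<forall>u\<in>Poly_Mapping.keys p. Poly_Mapping.keys u \<subseteq> X}"

definition pol_deg :: "'v set \<Rightarrow> nat \<Rightarrow> ('v, 'k::field) mpol set" where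
  "pol_deg X d = {p \<in> pol_vars X. \<forall>u\<in>Poly_Mapping.keys p. mdeg u = d}"

definition pol_deg_le :: "'v set \<Rightarrow> nat \<Rightarrow> ('v, 'k::field) mpol set" where
  "pol_deg_le X d = {p \<in> pol_vars X. \<forall>u\<in>Poly_Mapping.keys p. mdeg u \<le> d}"

definition hom_comp :: "nat \<Rightarrow> ('v, 'k::field) mpol \<Rightarrow> ('v, 'k) mpol" where
  "hom_comp d p = (\<Sum>u\<in>{u \<in> Poly_Mapping.keys p. mdeg u = d}.
     Poly_Mapping.single u (Poly_Mapping.lookup p u))"

definition dp_mult :: "'k::field dpol \<Rightarrow> 'k dpol \<Rightarrow> 'k dpol" where
  "dp_mult F G = (\<Sum>u\<in>Poly_Mapping.keys F. \<Sum>v\<in>Poly_Mapping.keys G.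
     Poly_Mapping.single (u + v)
       (of_nat (\<Prod>i\<in>Poly_Mapping.keys (u + v).
          (Poly_Mapping.lookup u i + Poly_Mapping.lookup v i) choose Poly_Mapping.lookup u i)
        * Poly_Mapping.lookup F u * Poly_Mapping.lookup G v))"

definition contract :: "(nat, 'k::field) mpol \<Rightarrow> 'k dpol \<Rightarrow> 'k dpol" where
  "contract \<theta> F = (\<Sum>u\<in>Poly_Mapping.keys \<theta>. \<Sum>v\<in>Poly_Mapping.keys F.
     if \<forall>i. Poly_Mapping.lookup u i \<le> Poly_Mapping.lookup v i
     then Poly_Mapping.single (v - u) (Poly_Mapping.lookup \<theta> u * Poly_Mapping.lookup F v)
     else 0)"

definition Ann :: "nat \<Rightarrow> 'k::field dpol set \<Rightarrow> (nat, 'k) mpol set" where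
  "Ann n W = {\<theta> \<in> pol_vars {1..n}. \<forall>F\<in>W. contract \<theta> F = 0}"

definition homogenization :: "nat \<Rightarrow> nat \<Rightarrow> nat \<Rightarrow> 'k::field dpol set \<Rightarrow> 'k dpol set" where
  "homogenization n d\<^sub>1 d\<^sub>2 W =
     {\<Sum>i\<le>d\<^sub>1. dp_mult (F i) (Poly_Mapping.single (Poly_Mapping.single 0 (d\<^sub>1 + d\<^sub>2 - i)) 1) | F.
        (\<forall>i. F i \<in> pol_deg {1..n} i) \<and> (\<Sum>i\<le>d\<^sub>1. F i) \<in> W}"


section \<open>Zero-dimensional subschemes and the Veronese map\<close>

text \<open>
  The homogeneous coordinate ring of \<open>\<P>T\<^sub>1\<close> is \<open>T*\<close>. A closed subscheme of \<open>\<P>T\<^sub>1\<close> is represented by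
  its saturated homogeneous ideal in \<open>T*\<close>. It is zero-dimensional of length \<open>r > 0\<close> iff its Hilbert
  polynomial is the constant \<open>r\<close>.
\<close>

definition hom_ideal :: "nat \<Rightarrow> (nat, 'k::field) mpol set \<Rightarrow> bool" where
  "hom_ideal n I \<longleftrightarrow>
     I \<subseteq> pol_vars {0..n} \<and> 0 \<in> I \<and> (\<forall>f\<in>I. \<forall>g\<in>I. f + g \<in> I) \<and>
     (\<forall>f\<in>I. \<forall>g\<in>pol_vars {0..n}. g * f \<in> I) \<and>
     (\<forall>f\<in>I. \<forall>d. hom_comp d f \<in> I)"

definition saturated :: "nat \<Rightarrow> (nat, 'k::field) mpol set \<Rightarrow> bool" where
  "saturated n I \<longleftrightarrow>
     (\<forall>f\<in>pol_vars {0..n}. (\<exists>m. \<forall>g\<in>pol_deg {0..n} m. g * f \<in> I) \<longrightarrow> f \<in> I)"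

definition zero_dim_subscheme :: "nat \<Rightarrow> nat \<Rightarrow> (nat, 'k::field) mpol set \<Rightarrow> bool" where
  "zero_dim_subscheme n r I \<longleftrightarrow>
     hom_ideal n I \<and> saturated n I \<and> r > 0 \<and>
     (\<exists>e\<^sub>0. \<forall>e\<ge>e\<^sub>0. quot_dim (pol_deg {0..n} e) (I \<inter> pol_deg {0..n} e) = r)"

definition expos :: "nat \<Rightarrow> nat \<Rightarrow> nat expo set" where
  "expos n d = {u. Poly_Mapping.keys u \<subseteq> {0..n} \<and> mdeg u = d}"

text \<open>\<open>lin_dp_power n a d\<close> is \<open>L\<^sup>[\<^sup>d\<^sup>]\<close> for \<open>L = \<Sum>\<^sub>i a\<^sub>i x\<^sub>i\<close>.\<close>

definition lin_dp_power :: "nat \<Rightarrow> (nat \<Rightarrow> 'k::field) \<Rightarrow> nat \<Rightarrow> 'k dpol" where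
  "lin_dp_power n a d = (\<Sum>u\<in>expos n d.
     Poly_Mapping.single u (\<Prod>i\<in>Poly_Mapping.keys u. a i ^ Poly_Mapping.lookup u i))"

text \<open>
  The pullback along \<open>\<nu>\<^sub>d\<close> of a linear form \<open>\<phi>\<close> on \<open>T\<^sub>d\<close> is the degree \<open>d\<close> form \<open>L \<mapsto> \<phi> (L\<^sup>[\<^sup>d\<^sup>])\<close>, that is,
  \<open>\<Sum>\<^sub>u \<phi> (x\<^sup>[\<^sup>u\<^sup>]) \<alpha>\<^sup>u\<close>; lemma \<open>mpol_eval_veronese_pullback\<close> confirms this on points.
\<close>

definition veronese_pullback :: "nat \<Rightarrow> nat \<Rightarrow> ('k::field dpol \<Rightarrow> 'k) \<Rightarrow> (nat, 'k) mpol" where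
  "veronese_pullback n d \<phi> =
     (\<Sum>u\<in>expos n d. Poly_Mapping.single u (\<phi> (Poly_Mapping.single u 1)))"

lemma finite_expos: "finite (expos n d)"
proof -
  have "Poly_Mapping.lookup ` expos n d \<subseteq>
        {f. \<forall>i. (i \<in> {0..n} \<longrightarrow> f i \<in> {0..d}) \<and> (i \<notin> {0..n} \<longrightarrow> f i = 0)}"
  proof clarify
    fix u i assume u: "u \<in> expos n d"
    have "Poly_Mapping.lookup u i \<le> d" if "i \<in> Poly_Mapping.keys u"
      using u that member_le_sum[of i "Poly_Mapping.keys u" "Poly_Mapping.lookup u"]
      by (simp add: expos_def mdeg_def)
    moreover have "Poly_Mapping.lookup u i = 0" if "i \<notin> Poly_Mapping.keys u"
      using that by (simp add: in_keys_iff)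
    ultimately show "(i \<in> {0..n} \<longrightarrow> Poly_Mapping.lookup u i \<in> {0..d}) \<and>
                     (i \<notin> {0..n} \<longrightarrow> Poly_Mapping.lookup u i = 0)"
      using u by (cases "i \<in> Poly_Mapping.keys u") (auto simp: expos_def)
  qed
  moreover have "finite {f. \<forall>i. (i \<in> {0..n} \<longrightarrow> f i \<in> {0..d}) \<and> (i \<notin> {0..n} \<longrightarrow> f i = (0::nat))}"
    by (rule finite_set_of_finite_funs) auto
  ultimately have "finite (Poly_Mapping.lookup ` expos n d)"
    by (rule finite_subset)
  thus ?thesis
    by (rule finite_imageD) (auto simp: inj_on_def)
qed

lemma mpol_eval_veronese_pullback:
  assumes "Vector_Spaces.linear pm_scale (*) \<phi>"
  shows "mpol_eval a (veronese_pullback n d \<phi>) = \<phi> (lin_dp_power n a d)"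
proof -
  interpret \<phi>: Vector_Spaces.linear pm_scale "(*)" \<phi> by fact
  let ?P = "veronese_pullback n d \<phi>"
  let ?m = "\<lambda>u. \<Prod>i\<in>Poly_Mapping.keys u. a i ^ Poly_Mapping.lookup u i"
  have lk: "Poly_Mapping.lookup ?P u = (if u \<in> expos n d then \<phi> (Poly_Mapping.single u 1) else 0)" for u
    by (simp add: veronese_pullback_def lookup_sum lookup_single when_def finite_expos sum.delta)
  have "mpol_eval a ?P = (\<Sum>u\<in>expos n d. Poly_Mapping.lookup ?P u * ?m u)"
    unfolding mpol_eval_def
    by (rule sum.mono_neutral_left) (auto simp: finite_expos in_keys_iff lk split: if_splits)
  also have "\<dots> = (\<Sum>u\<in>expos n d. \<phi> (pm_scale (?m u) (Poly_Mapping.single u 1)))"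
    by (intro sum.cong) (auto simp: lk \<phi>.scale)
  also have "\<dots> = (\<Sum>u\<in>expos n d. \<phi> (Poly_Mapping.single u (?m u)))"
    by (intro sum.cong arg_cong[where f = \<phi>] poly_mapping_eqI refl)
       (simp add: lookup_single when_def)
  also have "\<dots> = \<phi> (lin_dp_power n a d)"
    by (simp add: lin_dp_power_def \<phi>.sum)
  finally show ?thesis .
qed

text \<open>
  The linear span of the scheme \<open>\<nu>\<^sub>d(R)\<close>, as a linear subspace of \<open>T\<^sub>d\<close>: the intersection of all
  hyperplanes containing \<open>\<nu>\<^sub>d(R)\<close> scheme-theoretically. The hyperplane \<open>\<phi> = 0\<close> contains \<open>\<nu>\<^sub>d(R)\<close> iff
  the pullback of \<open>\<phi>\<close> lies in the saturated ideal \<open>I\<close> of \<open>R\<close>.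
\<close>

definition veronese_span :: "nat \<Rightarrow> nat \<Rightarrow> (nat, 'k::field) mpol set \<Rightarrow> 'k dpol set" where
  "veronese_span n d I =
     {F \<in> pol_deg {0..n} d.
        \<forall>\<phi>. Vector_Spaces.linear pm_scale (*) \<phi> \<and> veronese_pullback n d \<phi> \<in> I \<longrightarrow> \<phi> F = 0}"


section \<open>Cactus rank and border cactus rank\<close>

text \<open>The ranks are infima in \<^typ>\<open>enat\<close>, so that no value has to be fixed for an empty set.\<close>

definition cactus_rank :: "nat \<Rightarrow> nat \<Rightarrow> 'k::field dpol set \<Rightarrow> enat" where
  "cactus_rank n d V =
     Inf {enat r | r. r > 0 \<and> (\<exists>I. zero_dim_subscheme n r I \<and> V \<subseteq> veronese_span n d I)}"

definition Gr :: "nat \<Rightarrow> nat \<Rightarrow> nat \<Rightarrow> 'k::field dpol set set" where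
  "Gr n d k = {V. pm.subspace V \<and> V \<subseteq> pol_deg {0..n} d \<and> pm.dim V = k}"

definition basis_list :: "'k::field dpol set \<Rightarrow> 'k dpol list \<Rightarrow> bool" where
  "basis_list V bs \<longleftrightarrow> distinct bs \<and> pm.independent (set bs) \<and> pm.span (set bs) = V"

text \<open>
  The Zariski topology on \<open>Gr(k, T\<^sub>d)\<close> is the one induced by the Pluecker embedding. Pluecker
  coordinates are indexed by \<open>k\<close>-tuples of monomials of degree \<open>d\<close>; tuples which are not strictly
  increasing in some order only add coordinates that vanish or agree with others up to sign.
\<close>

definition plucker :: "'k::field dpol list \<Rightarrow> nat expo list \<Rightarrow> 'k" where
  "plucker bs us =
     det (mat (length bs) (length bs) (\<lambda>(i, j). Poly_Mapping.lookup (bs ! i) (us ! j)))"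

definition plucker_forms :: "nat \<Rightarrow> nat \<Rightarrow> nat \<Rightarrow> (nat expo list, 'k::field) mpol set" where
  "plucker_forms n d k = (\<Union>e. pol_deg {us. length us = k \<and> set us \<subseteq> expos n d} e)"

definition Gr_closed :: "nat \<Rightarrow> nat \<Rightarrow> nat \<Rightarrow> 'k::field dpol set set \<Rightarrow> bool" where
  "Gr_closed n d k Z \<longleftrightarrow>
     (\<exists>\<P>. \<P> \<subseteq> plucker_forms n d k \<and>
        Z = {V \<in> Gr n d k. \<forall>P\<in>\<P>. \<forall>bs. basis_list V bs \<longrightarrow> mpol_eval (plucker bs) P = 0})"

definition Gr_closure :: "nat \<Rightarrow> nat \<Rightarrow> nat \<Rightarrow> 'k::field dpol set set \<Rightarrow> 'k dpol set set" where
  "Gr_closure n d k X = \<Inter>{Z. Gr_closed n d k Z \<and> X \<subseteq> Z}"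

definition cactus_variety :: "nat \<Rightarrow> nat \<Rightarrow> nat \<Rightarrow> nat \<Rightarrow> 'k::field dpol set set" where
  "cactus_variety n d r k = Gr_closure n d k {V \<in> Gr n d k. cactus_rank n d V \<le> enat r}"

definition border_cactus_rank :: "nat \<Rightarrow> nat \<Rightarrow> 'k::field dpol set \<Rightarrow> enat" where
  "border_cactus_rank n d V = Inf {enat r | r. r > 0 \<and> V \<in> cactus_variety n d r (pm.dim V)}"

end

theory Submission
  imports Defs
begin

text \<open>
  For the upper bound, take the closure in projective space of \<open>Spec S*/Ann(W)\<close>: since \<open>Ann(W)\<close> contains
  all forms of degree above \<open>d\<^sub>1\<close>, it has length \<open>r\<close>, and its ideal kills the homogenization of \<open>W\<close>.
  For the lower bound, consider the catalecticant that pairs \<open>T*\<close> in degree \<open>d\<^sub>1\<close> with \<open>T*\<close> in degree \<open>d\<^sub>2\<close> and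
  takes values in the dual of \<open>V\<close>. If the span of a scheme of length \<open>s\<close> contains \<open>V\<close>, the catalecticant factors
  through the coordinate ring of the scheme in degree \<open>d\<^sub>1\<close>, whose dimension is at most \<open>s\<close>, so its rank is
  at most \<open>s\<close>. This is a closed condition on \<open>V\<close>, and for the homogenization of \<open>W\<close> the rank is \<open>r\<close> when
  \<open>d\<^sub>1 \<le> d\<^sub>2\<close>.
\<close>

text \<open>The length of a subscheme enters only as the eventual value of its Hilbert function,
  whereas the catalecticant lives in the possibly small degree \<open>d\<^sub>1\<close>. The bound
  has to be carried down from large degrees, and this is where saturation is used. The degree
  \<open>d\<^sub>1\<close> is chosen because every class of \<open>S*/Ann(W)\<close> has a
  representative of degree at most \<open>d\<^sub>1\<close>, so that forms of degree exactly
  \<open>d\<^sub>1\<close> already see all \<open>r\<close> dimensions. The second obstacle is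
  closedness: it must be witnessed by forms in the Pluecker coordinates, while the entries of a
  catalecticant are coefficients of elements of \<open>V\<close> and depend on a choice of elements.
  Each entry is therefore taken to be a single Pluecker coordinate in which one monomial of a fixed
  tuple varies. Quotient spaces are handled as images of linear maps with prescribed kernel, and
  membership in an annihilator or an ideal as vanishing of pairings with explicit functions, so that
  most verifications become shifts of exponents.\<close>

abbreviation lookup :: "('a \<Rightarrow>\<^sub>0 'b::zero) \<Rightarrow> 'a \<Rightarrow> 'b" where
  "lookup \<equiv> Poly_Mapping.lookup"

abbreviation keys :: "('a \<Rightarrow>\<^sub>0 'b::zero) \<Rightarrow> 'a set" where
  "keys \<equiv> Poly_Mapping.keys"

abbreviation single :: "'a \<Rightarrow> 'b::zero \<Rightarrow> 'a \<Rightarrow>\<^sub>0 'b" where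
  "single \<equiv> Poly_Mapping.single"

section \<open>Pairing and pushforward of finitely supported functions\<close>

text \<open>Coefficient extraction, contraction, evaluation at a point and the tests defining the
  ideals below are all sums of this shape. Leaving \<open>h\<close> an arbitrary function on
  monomials lets indicators and shifted coefficient functions be substituted freely.\<close>

definition pairing :: "('m \<Rightarrow>\<^sub>0 'k::field) \<Rightarrow> ('m \<Rightarrow> 'k) \<Rightarrow> 'k" where
  "pairing p h = (\<Sum>u\<in>keys p. lookup p u * h u)"

lemma pairing_superset:
  assumes "finite A" "keys p \<subseteq> A"
  shows "pairing p h = (\<Sum>u\<in>A. lookup p u * h u)"
  unfolding pairing_def using assms
  by (intro sum.mono_neutral_left) (auto simp: in_keys_iff)

lemma pairing_0 [simp]: "pairing 0 h = 0"
  by (simp add: pairing_def)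

lemma pairing_add: "pairing (p + q) h = pairing p h + pairing q h"
proof -
  let ?A = "keys p \<union> keys q"
  have "pairing (p + q) h = (\<Sum>u\<in>?A. lookup (p + q) u * h u)"
    by (rule pairing_superset) (use keys_add[of p q] in auto)
  also have "\<dots> = (\<Sum>u\<in>?A. lookup p u * h u) + (\<Sum>u\<in>?A. lookup q u * h u)"
    by (simp add: lookup_add sum.distrib algebra_simps)
  also have "\<dots> = pairing p h + pairing q h"
    by (subst (1 2) pairing_superset[of ?A]) auto
  finally show ?thesis .
qed

lemma pairing_pm_scale: "pairing (pm_scale c p) h = c * pairing p h"
proof -
  have "pairing (pm_scale c p) h = (\<Sum>u\<in>keys p. lookup (pm_scale c p) u * h u)"
    by (rule pairing_superset) (auto simp: in_keys_iff)
  thus ?thesis by (simp add: pairing_def sum_distrib_left mult_ac)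
qed

lemma pairing_single [simp]: "pairing (single u c) h = c * h u"
  by (simp add: pairing_def)

lemma pairing_sum: "pairing (\<Sum>x\<in>X. p x) h = (\<Sum>x\<in>X. pairing (p x) h)"
  by (induction X rule: infinite_finite_induct) (auto simp: pairing_add)

lemma pairing_cong: "(\<And>u. u \<in> keys p \<Longrightarrow> h u = h' u) \<Longrightarrow> pairing p h = pairing p h'"
  by (auto simp: pairing_def intro: sum.cong)

lemma pairing_zero_right [simp]: "pairing p (\<lambda>u. 0) = 0"
  by (simp add: pairing_def)

lemma lookup_eq_pairing: "lookup p u = pairing p (\<lambda>v. if v = u then 1 else 0)"
proof -
  have "pairing p (\<lambda>v. if v = u then 1 else 0) = (\<Sum>v\<in>keys p. if v = u then lookup p v else 0)"
    unfolding pairing_def by (rule sum.cong) auto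
  also have "\<dots> = lookup p u"
    by (simp add: in_keys_iff)
  finally show ?thesis ..
qed

lemma sum_single_keys: "(\<Sum>u\<in>keys p. single u (lookup p u)) = p"
proof (rule poly_mapping_eqI)
  fix w
  have "lookup (\<Sum>u\<in>keys p. single u (lookup p u)) w
      = (\<Sum>u\<in>keys p. if u = w then lookup p u else 0)"
    by (simp add: lookup_sum lookup_single when_def)
  thus "lookup (\<Sum>u\<in>keys p. single u (lookup p u)) w = lookup p w"
    by (simp add: in_keys_iff)
qed

lemma single_eq_pm_scale: "single u c = pm_scale c (single u 1)"
  by (rule poly_mapping_eqI) (simp add: lookup_single when_def)

lemma pm_scale_eq_mult: "pm_scale c p = single 0 c * p"
  by (simp add: pm_scale_def mult_map_scale_conv_mult)

text \<open>Multiplication by a monomial is transposed to a shift of the test function; the ideal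
  and saturation properties below rest on this.\<close>

lemma pairing_single_mult:
  fixes p :: "'m::comm_monoid_add \<Rightarrow>\<^sub>0 'k::field"
  shows "pairing (single v c * p) h = c * pairing p (\<lambda>u. h (v + u))"
proof -
  have "single v c * p = (\<Sum>u\<in>keys p. single (v + u) (c * lookup p u))"
    by (subst sum_single_keys[of p, symmetric]) (simp add: sum_distrib_left mult_single)
  hence "pairing (single v c * p) h = (\<Sum>u\<in>keys p. c * lookup p u * h (v + u))"
    by (simp only: pairing_sum pairing_single)
  thus ?thesis
    by (simp add: pairing_def sum_distrib_left mult.assoc)
qed

lemma mpol_eval_eq_pairing:
  "mpol_eval a p = pairing p (\<lambda>u. \<Prod>i\<in>keys u. a i ^ lookup u i)"
  by (simp add: mpol_eval_def pairing_def)

definition pushforward :: "('m \<Rightarrow> 'l) \<Rightarrow> ('m \<Rightarrow>\<^sub>0 'k::field) \<Rightarrow> ('l \<Rightarrow>\<^sub>0 'k)" where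
  "pushforward \<sigma> p = (\<Sum>u\<in>keys p. single (\<sigma> u) (lookup p u))"

text \<open>Moving monomials along \<open>\<sigma>\<close> is the transpose of precomposing the test
  function with \<open>\<sigma>\<close>.\<close>

lemma pairing_pushforward: "pairing (pushforward \<sigma> p) h = pairing p (\<lambda>u. h (\<sigma> u))"
  by (simp add: pushforward_def pairing_sum) (simp add: pairing_def)

lemma lookup_pushforward:
  "lookup (pushforward \<sigma> p) u = pairing p (\<lambda>v. if \<sigma> v = u then 1 else 0)"
  by (simp add: lookup_eq_pairing pairing_pushforward)

lemma keys_pushforward: "keys (pushforward \<sigma> p) \<subseteq> \<sigma> ` keys p"
  unfolding pushforward_def by (rule order_trans[OF keys_sum]) auto

abbreviation pm_linear :: "(('m \<Rightarrow>\<^sub>0 'k::field) \<Rightarrow> ('l \<Rightarrow>\<^sub>0 'k)) \<Rightarrow> bool" where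
  "pm_linear \<equiv> Vector_Spaces.linear pm_scale pm_scale"

lemma pm_linearI:
  assumes "\<And>p q. g (p + q) = g p + g q" "\<And>c p. g (pm_scale c p) = pm_scale c (g p)"
  shows "pm_linear g"
  by unfold_locales (fact assms)+

lemma pm_linear_pushforward: "pm_linear (pushforward \<sigma>)"
  by (rule pm_linearI)
     (auto intro!: poly_mapping_eqI simp: lookup_pushforward lookup_add pairing_add pairing_pm_scale)

lemma pm_linear_compose: "pm_linear f \<Longrightarrow> pm_linear g \<Longrightarrow> pm_linear (\<lambda>x. g (f x))"
  using Vector_Spaces.linear_compose[of pm_scale pm_scale f pm_scale g] by (simp add: o_def)

section \<open>Dimension of a quotient\<close>

text \<open>Realizes the quotient by \<open>A\<close> inside the same type: extend a basis
  \<open>C\<close> of \<open>A\<close> to a basis \<open>D\<close> of the whole space and project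
  along \<open>A\<close> onto the span of \<open>D - C\<close>.\<close>

lemma pm_linear_with_kernel:
  fixes A :: "('m \<Rightarrow>\<^sub>0 'k::field) set"
  assumes "pm.subspace A"
  obtains g :: "('m \<Rightarrow>\<^sub>0 'k) \<Rightarrow> ('m \<Rightarrow>\<^sub>0 'k)"
  where "pm_linear g" "\<And>x. g x = 0 \<longleftrightarrow> x \<in> A"
proof -
  interpret vp: vector_space_pair "pm_scale :: 'k \<Rightarrow> ('m \<Rightarrow>\<^sub>0 'k) \<Rightarrow> _" "pm_scale :: 'k \<Rightarrow> ('m \<Rightarrow>\<^sub>0 'k) \<Rightarrow> _"
    by unfold_locales
  obtain C where C: "C \<subseteq> A" "pm.independent C" "A \<subseteq> pm.span C"
    using pm.maximal_independent_subset by blast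
  have span_C: "pm.span C = A"
    using C pm.span_minimal[OF C(1) assms] by auto
  define D where "D = pm.extend_basis C"
  have D: "C \<subseteq> D" "pm.independent D" "pm.span D = UNIV"
    unfolding D_def using C(2)
    by (auto simp: pm.extend_basis_superset pm.independent_extend_basis)
  obtain g where g: "pm_linear g" "\<And>x. x \<in> D \<Longrightarrow> g x = (if x \<in> C then 0 else x)"
    using vp.linear_independent_extend[OF D(2), of "\<lambda>x. if x \<in> C then 0 else x"] by blast
  interpret g: Vector_Spaces.linear pm_scale pm_scale g by (rule g(1))
  have zero: "g x = 0" if "x \<in> pm.span C" for x
    by (rule g.eq_0_on_span[OF _ that]) (use g(2) D(1) in auto)
  have "x \<in> A" if "g x = 0" for x
  proof -
    have "x \<in> pm.span (C \<union> (D - C))"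
      using D by (simp add: Un_absorb1)
    then obtain y z where yz: "x = y + z" "y \<in> pm.span C" "z \<in> pm.span (D - C)"
      unfolding pm.span_Un by auto
    have "g z = z"
      using yz(3)
      by (induction rule: pm.span_induct_alt) (use g(2) in \<open>auto simp: g.add g.scale\<close>)
    hence "z = 0"
      using that yz zero[of y] by (simp add: g.add)
    thus ?thesis using yz span_C by simp
  qed
  thus ?thesis using that[OF g(1)] zero span_C by auto
qed

lemma quot_dim_eq_dim_image:
  assumes U: "pm.subspace U" and A: "pm.subspace A" and g: "pm_linear g"
    and ker: "\<And>x. x \<in> U \<Longrightarrow> g x = 0 \<longleftrightarrow> x \<in> A"
  shows "quot_dim U A = pm.dim (g ` U)"
proof -
  interpret g: Vector_Spaces.linear pm_scale pm_scale g by (rule g)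
  have comb: "g (\<Sum>b\<in>C. pm_scale (c b) b) = (\<Sum>b\<in>C. pm_scale (c b) (g b))" for C c
    by (simp add: g.sum g.scale)
  have 1: "card B = pm.dim (g ` U)" if B: "basis_mod U A B" for B
  proof -
    have BU: "B \<subseteq> U" and
      ind: "\<And>C c b. finite C \<Longrightarrow> C \<subseteq> B \<Longrightarrow> (\<Sum>b\<in>C. pm_scale (c b) b) \<in> A \<Longrightarrow> b \<in> C \<Longrightarrow> c b = 0" and
      sp: "\<And>u. u \<in> U \<Longrightarrow> \<exists>b\<in>pm.span B. u - b \<in> A"
      using B unfolding basis_mod_def by blast+
    have inU: "(\<Sum>b\<in>C. pm_scale (c b) b) \<in> U" if "C \<subseteq> B" for C c
      using that BU by (intro pm.subspace_sum[OF U] pm.subspace_scale[OF U]) auto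
    have ind': "c b = 0" if "finite C" "C \<subseteq> B" "(\<Sum>b\<in>C. pm_scale (c b) (g b)) = 0" "b \<in> C" for C c b
      by (rule ind[OF that(1,2) _ that(4)]) (use that ker[OF inU[OF that(2)]] comb in auto)
    have inj: "inj_on g B"
    proof (rule inj_onI, rule ccontr)
      fix x y assume *: "x \<in> B" "y \<in> B" "g x = g y" "x \<noteq> y"
      show False
        using ind'[of "{x, y}" "\<lambda>z. if z = x then 1 else - 1" x] * by (auto simp: pm.scale_minus_left)
    qed
    have "pm.independent (g ` B)"
      unfolding pm.independent_explicit_module
    proof (intro allI impI)
      fix T c v assume *: "finite T" "T \<subseteq> g ` B" "(\<Sum>v\<in>T. pm_scale (c v) v) = 0" "v \<in> T"
      obtain C where C: "C \<subseteq> B" "T = g ` C"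
        using *(2) by (meson subset_imageE)
      have injC: "inj_on g C" using inj C(1) by (rule inj_on_subset)
      have "finite C" using *(1) C injC by (simp add: finite_image_iff)
      moreover have "(\<Sum>b\<in>C. pm_scale (c (g b)) (g b)) = 0"
        using *(3) unfolding C(2) by (simp add: sum.reindex[OF injC])
      ultimately show "c v = 0"
        using ind'[of C "\<lambda>b. c (g b)"] C *(4) by auto
    qed
    moreover have "g ` U \<subseteq> pm.span (g ` B)"
    proof clarify
      fix u assume u: "u \<in> U"
      obtain b where b: "b \<in> pm.span B" "u - b \<in> A" using sp[OF u] by blast
      have "b \<in> U" using b(1) BU U by (meson pm.span_minimal subsetD)
      hence "g (u - b) = 0" using ker[of "u - b"] b u U by (simp add: pm.subspace_diff)
      hence "g u = g b" by (simp add: g.diff)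
      thus "g u \<in> pm.span (g ` B)" using b(1) g.span_image[of B] by auto
    qed
    ultimately have "card (g ` B) = pm.dim (g ` U)"
      by (intro pm.basis_card_eq_dim) (use BU in auto)
    thus ?thesis using card_image[OF inj] by simp
  qed
  have "\<exists>B. basis_mod U A B"
  proof -
    obtain B' where B': "B' \<subseteq> g ` U" "pm.independent B'" "g ` U \<subseteq> pm.span B'"
      using pm.maximal_independent_subset by blast
    obtain B where B: "B \<subseteq> U" "inj_on g B" "B' = g ` B"
      using B'(1) by (auto simp: subset_image_inj)
    have "basis_mod U A B"
      unfolding basis_mod_def
    proof (intro conjI allI impI ballI)
      show "B \<subseteq> U" by fact
    next
      fix C c b assume *: "finite C \<and> C \<subseteq> B \<and> (\<Sum>b\<in>C. pm_scale (c b) b) \<in> A" "b \<in> C"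
      have injC: "inj_on g C" using B(2) * by (meson inj_on_subset)
      have "(\<Sum>b\<in>C. pm_scale (c b) b) \<in> U"
        using * B(1) by (intro pm.subspace_sum[OF U] pm.subspace_scale[OF U]) auto
      hence "(\<Sum>b\<in>C. pm_scale (c b) (g b)) = 0" using ker * comb by metis
      hence "(\<Sum>v\<in>g ` C. pm_scale (c (the_inv_into C g v)) v) = 0"
        by (simp add: sum.reindex[OF injC] the_inv_into_f_f[OF injC] cong: sum.cong)
      hence "c (the_inv_into C g (g b)) = 0"
        using * B(3)
        by (intro pm.independentD[OF B'(2), where t = "g ` C" and v = "g b"]) auto
      thus "c b = 0" using *(2) by (simp add: the_inv_into_f_f[OF injC])
    next
      fix u assume u: "u \<in> U"
      hence "g u \<in> g ` pm.span B" using B' B(3) g.span_image[of B] by auto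
      then obtain b where b: "b \<in> pm.span B" "g u = g b" by auto
      have "b \<in> U" using b(1) B(1) U by (meson pm.span_minimal subsetD)
      hence "u - b \<in> A" using ker[of "u - b"] b u U by (simp add: pm.subspace_diff g.diff)
      thus "\<exists>b\<in>pm.span B. u - b \<in> A" using b by blast
    qed
    thus ?thesis ..
  qed
  thus ?thesis unfolding quot_dim_def using 1 someI_ex[of "basis_mod U A"] by auto
qed

section \<open>Monomials and the ideal of the homogenized apolar scheme\<close>

lemma mdeg_superset: "finite A \<Longrightarrow> keys u \<subseteq> A \<Longrightarrow> mdeg u = (\<Sum>i\<in>A. lookup u i)"
  unfolding mdeg_def by (intro sum.mono_neutral_left) (auto simp: in_keys_iff)

lemma keys_add_expo: "keys (u + v) = keys u \<union> keys (v :: 'v expo)"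
  by (auto simp: in_keys_iff lookup_add)

lemma mdeg_add: "mdeg (u + v) = mdeg u + mdeg v"
proof -
  let ?A = "keys u \<union> keys v"
  have "mdeg (u + v) = (\<Sum>i\<in>?A. lookup u i + lookup v i)"
    by (subst mdeg_superset[of ?A]) (auto simp: keys_add_expo lookup_add)
  also have "\<dots> = mdeg u + mdeg v"
    by (subst (1 2) mdeg_superset[of ?A]) (auto simp: sum.distrib)
  finally show ?thesis .
qed

lemma mdeg_single [simp]: "mdeg (single i c) = c"
  by (simp add: mdeg_def)

lemma mdeg_0 [simp]: "mdeg 0 = 0"
  by (simp add: mdeg_def)

lemma mdeg_sum: "mdeg (\<Sum>x\<in>X. u x) = (\<Sum>x\<in>X. mdeg (u x))"
  by (induction X rule: infinite_finite_induct) (auto simp: mdeg_add)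

section \<open>Homogenization and dehomogenization of monomials\<close>

definition bar :: "nat expo \<Rightarrow> nat expo" where
  "bar u = u - single 0 (lookup u 0)"

lemma lookup_bar: "lookup (bar u) i = (if i = 0 then 0 else lookup u i)"
  by (simp add: bar_def lookup_minus lookup_single when_def)

lemma bar_add: "bar (u + v) = bar u + bar v"
  by (rule poly_mapping_eqI) (simp add: lookup_bar lookup_add)

lemma bar_single_0 [simp]: "bar (single 0 c) = 0"
  by (rule poly_mapping_eqI) (simp add: lookup_bar lookup_single when_def)

lemma keys_bar: "keys (bar u) = keys u - {0}"
  by (auto simp: in_keys_iff lookup_bar split: if_splits)

lemma bar_eq_self: "0 \<notin> keys u \<Longrightarrow> bar u = u"
  by (rule poly_mapping_eqI) (auto simp: lookup_bar in_keys_iff)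

lemma bar_plus_single: "bar u + single 0 (lookup u 0) = u"
  by (rule poly_mapping_eqI) (simp add: lookup_bar lookup_add lookup_single when_def)

lemma mdeg_bar: "mdeg (bar u) + lookup u 0 = mdeg u"
  by (metis bar_plus_single mdeg_add mdeg_single)

text \<open>\<open>homogenize e\<close> fills up with powers of \<open>x\<^sub>0\<close> to degree \<open>e\<close>; it is used for both \<open>S\<close> and \<open>S*\<close>.\<close>

definition homogenize_expo :: "nat \<Rightarrow> nat expo \<Rightarrow> nat expo" where
  "homogenize_expo e u = u + single 0 (e - mdeg u)"

definition homogenize :: "nat \<Rightarrow> 'k::field dpol \<Rightarrow> 'k dpol" where
  "homogenize e = pushforward (homogenize_expo e)"

definition dehomogenize :: "(nat, 'k::field) mpol \<Rightarrow> (nat, 'k) mpol" where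
  "dehomogenize = pushforward bar"

lemma mdeg_homogenize_expo: "mdeg u \<le> e \<Longrightarrow> mdeg (homogenize_expo e u) = e"
  by (simp add: homogenize_expo_def mdeg_add)

lemma homogenize_expo_in_expos:
  "keys u \<subseteq> {1..n} \<Longrightarrow> mdeg u \<le> e \<Longrightarrow> homogenize_expo e u \<in> expos n e"
  by (auto simp: expos_def homogenize_expo_def mdeg_add keys_add_expo split: if_splits)

lemma bar_homogenize_expo: "0 \<notin> keys u \<Longrightarrow> bar (homogenize_expo e u) = u"
  by (simp add: homogenize_expo_def bar_add bar_eq_self)

text \<open>Up to degree \<open>e\<close> the truncated subtraction in
  \<open>homogenize_expo\<close> is exact, so homogenizing is a bijection from the exponents without
  index 0 of degree at most \<open>e\<close> onto the exponents of degree \<open>e\<close>, with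
  inverse \<open>bar\<close>.\<close>

lemma homogenize_expo_eq_iff:
  assumes "0 \<notin> keys v" "mdeg v \<le> e"
  shows "homogenize_expo e v = u \<longleftrightarrow> v = bar u \<and> mdeg u = e"
proof
  assume "v = bar u \<and> mdeg u = e"
  moreover have "mdeg u - mdeg (bar u) = lookup u 0" using mdeg_bar[of u] by simp
  ultimately show "homogenize_expo e v = u"
    using bar_plus_single[of u] by (auto simp: homogenize_expo_def)
next
  assume "homogenize_expo e v = u"
  thus "v = bar u \<and> mdeg u = e"
    using assms bar_homogenize_expo[of v e] mdeg_homogenize_expo[of v e] by auto
qed

lemma pol_deg_leD:
  fixes F :: "'k::field dpol"
  shows "F \<in> pol_deg_le {1..n} d \<Longrightarrow> u \<in> keys F \<Longrightarrow> 0 \<notin> keys u \<and> keys u \<subseteq> {1..n} \<and> mdeg u \<le> d"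
proof -
  assume "F \<in> pol_deg_le {1..n} d" "u \<in> keys F"
  hence "keys u \<subseteq> {1..n}" "mdeg u \<le> d" by (simp_all add: pol_deg_le_def pol_vars_def)
  moreover from this(1) have "0 \<notin> keys u" using subsetD[of "keys u" "{1..n}" 0] by auto
  ultimately show ?thesis by simp
qed

lemma lookup_homogenize:
  assumes "F \<in> pol_deg_le {1..n} d" "d \<le> e"
  shows "lookup (homogenize e F) u = (if mdeg u = e then lookup F (bar u) else 0)"
proof -
  have "lookup (homogenize e F) u = pairing F (\<lambda>v. if v = bar u \<and> mdeg u = e then 1 else 0)"
    unfolding homogenize_def lookup_pushforward
  proof (rule pairing_cong)
    fix v assume "v \<in> keys F"
    hence "homogenize_expo e v = u \<longleftrightarrow> v = bar u \<and> mdeg u = e"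
      using pol_deg_leD[OF assms(1), of v] assms(2) by (intro homogenize_expo_eq_iff) auto
    thus "(if homogenize_expo e v = u then 1 else 0 :: 'a) = (if v = bar u \<and> mdeg u = e then 1 else 0)"
      by simp
  qed
  also have "\<dots> = (if mdeg u = e then lookup F (bar u) else 0)"
    by (cases "mdeg u = e") (simp_all add: lookup_eq_pairing)
  finally show ?thesis .
qed

lemma homogenize_in_pol_deg:
  assumes "F \<in> pol_deg_le {1..n} d" "d \<le> e"
  shows "homogenize e F \<in> pol_deg {0..n} e"
proof -
  have "u \<in> expos n e" if u: "u \<in> keys (homogenize e F)" for u
  proof -
    obtain v where v: "v \<in> keys F" "u = homogenize_expo e v"
      using u keys_pushforward[of "homogenize_expo e" F] unfolding homogenize_def by auto
    show ?thesis
      using pol_deg_leD[OF assms(1) v(1)] assms(2) v(2) homogenize_expo_in_expos[of v n e] by simp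
  qed
  thus ?thesis
    by (auto simp: pol_deg_def pol_vars_def expos_def)
qed

lemma lookup_hom_comp: "lookup (hom_comp d p) u = (if mdeg u = d then lookup p u else 0)"
proof -
  have "lookup (hom_comp d p) u = (\<Sum>v\<in>{v \<in> keys p. mdeg v = d}. if v = u then lookup p v else 0)"
    by (simp add: hom_comp_def lookup_sum lookup_single when_def)
  thus ?thesis by (auto simp: in_keys_iff)
qed

lemma keys_hom_comp: "keys (hom_comp d p) = {u \<in> keys p. mdeg u = d}"
  by (auto simp: in_keys_iff lookup_hom_comp split: if_splits)

lemma sum_hom_comp:
  assumes "\<forall>u\<in>keys p. mdeg u \<le> d"
  shows "(\<Sum>i\<le>d. hom_comp i p) = p"
proof (rule poly_mapping_eqI)
  fix u
  have "lookup (\<Sum>i\<le>d. hom_comp i p) u = (if mdeg u \<le> d then lookup p u else 0)"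
    by (simp add: lookup_sum lookup_hom_comp)
  thus "lookup (\<Sum>i\<le>d. hom_comp i p) u = lookup p u"
    using assms by (auto simp: in_keys_iff)
qed

text \<open>The two factors share no variable, so every binomial coefficient in the divided power
  product is 1 and the product merely adds exponents, in any characteristic.\<close>

lemma dp_mult_x0_power:
  assumes "F \<in> pol_deg {1..n} i"
  shows "dp_mult F (single (single 0 (e - i)) 1) = homogenize e F"
proof -
  have "dp_mult F (single (single 0 (e - i)) 1) =
      (\<Sum>u\<in>keys F. single (u + single 0 (e - i)) (of_nat (\<Prod>j\<in>keys (u + single 0 (e - i)).
          (lookup u j + lookup (single 0 (e - i)) j) choose lookup u j) * lookup F u))"
    by (simp add: dp_mult_def)
  also have "\<dots> = (\<Sum>u\<in>keys F. single (homogenize_expo e u) (lookup F u))"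
  proof (rule sum.cong[OF refl])
    fix u assume u: "u \<in> keys F"
    have 0: "lookup u 0 = 0" "mdeg u = i"
      using u assms by (auto simp: pol_deg_def pol_vars_def in_keys_iff subset_iff)
    have "(\<Prod>j\<in>keys (u + single 0 (e - i)).
          (lookup u j + lookup (single 0 (e - i)) j) choose lookup u j) = 1"
      by (rule prod.neutral) (auto simp: lookup_single when_def 0)
    thus "single (u + single 0 (e - i)) (of_nat (\<Prod>j\<in>keys (u + single 0 (e - i)).
          (lookup u j + lookup (single 0 (e - i)) j) choose lookup u j) * lookup F u) =
        single (homogenize_expo e u) (lookup F u)"
      by (simp add: homogenize_expo_def 0)
  qed
  finally show ?thesis by (simp add: homogenize_def pushforward_def)
qed

lemma pm_linear_homogenize: "pm_linear (homogenize e)"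
  unfolding homogenize_def by (rule pm_linear_pushforward)

text \<open>By linearity the homogenized sum depends only on the sum of the chosen components, and
  the homogeneous components of an element of \<open>W\<close> supply an admissible choice.\<close>

lemma homogenization_eq_image:
  assumes "W \<subseteq> pol_deg_le {1..n} d\<^sub>1"
  shows "homogenization n d\<^sub>1 d\<^sub>2 W = homogenize (d\<^sub>1 + d\<^sub>2) ` W"
proof -
  interpret h: Vector_Spaces.linear pm_scale pm_scale "homogenize (d\<^sub>1 + d\<^sub>2) :: 'a dpol \<Rightarrow> _"
    by (rule pm_linear_homogenize)
  have 1: "(\<Sum>i\<le>d\<^sub>1. dp_mult (F i) (single (single 0 (d\<^sub>1 + d\<^sub>2 - i)) 1))
      = homogenize (d\<^sub>1 + d\<^sub>2) (\<Sum>i\<le>d\<^sub>1. F i)"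
    if "\<forall>i. F i \<in> pol_deg {1..n} i" for F :: "nat \<Rightarrow> 'a dpol"
    unfolding h.sum by (intro sum.cong refl dp_mult_x0_power[of _ n]) (use that in auto)
  have 2: "\<exists>G. (\<forall>i. G i \<in> pol_deg {1..n} i) \<and> (\<Sum>i\<le>d\<^sub>1. G i) = F" if "F \<in> W" for F
  proof (intro exI conjI allI)
    have F: "F \<in> pol_deg_le {1..n} d\<^sub>1" using that assms by auto
    show "hom_comp i F \<in> pol_deg {1..n} i" for i
      using F by (auto simp: pol_deg_def pol_deg_le_def pol_vars_def keys_hom_comp)
    show "(\<Sum>i\<le>d\<^sub>1. hom_comp i F) = F"
      by (rule sum_hom_comp) (use F in \<open>auto simp: pol_deg_le_def\<close>)
  qed
  show ?thesis
  proof (intro equalityI subsetI)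
    fix G assume "G \<in> homogenization n d\<^sub>1 d\<^sub>2 W"
    then obtain F where "\<forall>i. F i \<in> pol_deg {1..n} i" "(\<Sum>i\<le>d\<^sub>1. F i) \<in> W"
      "G = (\<Sum>i\<le>d\<^sub>1. dp_mult (F i) (single (single 0 (d\<^sub>1 + d\<^sub>2 - i)) 1))"
      unfolding homogenization_def by blast
    thus "G \<in> homogenize (d\<^sub>1 + d\<^sub>2) ` W"
      using 1[of F] by blast
  next
    fix G assume "G \<in> homogenize (d\<^sub>1 + d\<^sub>2) ` W"
    then obtain F where F: "F \<in> W" "G = homogenize (d\<^sub>1 + d\<^sub>2) F" by auto
    obtain H where H: "\<forall>i. H i \<in> pol_deg {1..n} i" "(\<Sum>i\<le>d\<^sub>1. H i) = F" using 2[OF F(1)] by auto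
    show "G \<in> homogenization n d\<^sub>1 d\<^sub>2 W"
      unfolding homogenization_def using 1[OF H(1)] H F by (intro CollectI exI[of _ H]) simp
  qed
qed

section \<open>Contraction and annihilators as linear conditions\<close>

text \<open>Contraction is the transpose of multiplication: the coefficient at \<open>w\<close>
  tests \<open>\<theta>\<close> against the coefficients of \<open>F\<close> shifted by
  \<open>w\<close>. Membership in \<open>Ann\<close> thus becomes a family of linear conditions
  indexed by \<open>F\<close> and \<open>w\<close>.\<close>

lemma lookup_contract: "lookup (contract \<theta> F) w = pairing \<theta> (\<lambda>u. lookup F (u + w))"
proof -
  have "lookup (if \<forall>i. lookup u i \<le> lookup v i then single (v - u) (lookup \<theta> u * lookup F v) else 0) w
     = (if v = u + w then lookup \<theta> u * lookup F v else 0)" for u v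
  proof -
    have "v - u = w \<longleftrightarrow> v = u + w" if "\<forall>i. lookup u i \<le> lookup v i"
      using that by (auto simp: poly_mapping_eq_iff lookup_add lookup_minus fun_eq_iff)
         (metis le_add_diff_inverse)
    moreover have "v \<noteq> u + w" if "\<not> (\<forall>i. lookup u i \<le> lookup v i)"
      using that by (auto simp: lookup_add)
    ultimately show ?thesis by (auto simp: lookup_single when_def)
  qed
  hence "lookup (contract \<theta> F) w
     = (\<Sum>u\<in>keys \<theta>. \<Sum>v\<in>keys F. if v = u + w then lookup \<theta> u * lookup F v else 0)"
    by (simp add: contract_def lookup_sum)
  also have "\<dots> = (\<Sum>u\<in>keys \<theta>. lookup \<theta> u * lookup F (u + w))"
    by (intro sum.cong refl) (auto simp: in_keys_iff)
  finally show ?thesis by (simp add: pairing_def)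
qed

lemma Ann_iff:
  "\<theta> \<in> Ann n W \<longleftrightarrow> \<theta> \<in> pol_vars {1..n} \<and> (\<forall>F\<in>W. \<forall>w. pairing \<theta> (\<lambda>u. lookup F (u + w)) = 0)"
  by (auto simp: Ann_def poly_mapping_eq_iff lookup_contract fun_eq_iff)

lemma keys_pm_scale: "keys (pm_scale c p) \<subseteq> keys p"
  by (auto simp: in_keys_iff)

lemma subspace_supported: "pm.subspace {p :: 'm \<Rightarrow>\<^sub>0 'k::field. \<forall>u\<in>keys p. P u}"
proof (rule pm.subspaceI)
  fix c and x y :: "'m \<Rightarrow>\<^sub>0 'k"
  assume "x \<in> {p. \<forall>u\<in>keys p. P u}"
  thus "pm_scale c x \<in> {p. \<forall>u\<in>keys p. P u}" using keys_pm_scale[of c x] by auto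
  assume "y \<in> {p. \<forall>u\<in>keys p. P u}"
  thus "x + y \<in> {p. \<forall>u\<in>keys p. P u}"
    using \<open>x \<in> _\<close> keys_add[of x y] by blast
qed auto

lemma subspace_pol_vars: "pm.subspace (pol_vars X)"
  unfolding pol_vars_def by (rule subspace_supported)

lemma pol_deg_eq: "pol_deg X d = {p. \<forall>u\<in>keys p. keys u \<subseteq> X \<and> mdeg u = d}"
  by (auto simp: pol_deg_def pol_vars_def)

lemma subspace_pol_deg: "pm.subspace (pol_deg X d)"
  unfolding pol_deg_eq by (rule subspace_supported)

lemma subspace_Ann: "pm.subspace (Ann n W)"
  by (rule pm.subspaceI)
     (auto simp: Ann_iff pairing_add pairing_pm_scale pm.subspace_0[OF subspace_pol_vars]
        pm.subspace_scale[OF subspace_pol_vars] pm.subspace_add[OF subspace_pol_vars])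

text \<open>
  The saturated homogeneous ideal of the closure in \<open>\<P>T\<^sub>1\<close> of the affine scheme
  \<open>Spec S*/Ann(W)\<close>: a form belongs to it iff its dehomogenization annihilates \<open>W\<close>.
\<close>

definition Ann_closure :: "nat \<Rightarrow> 'k::field dpol set \<Rightarrow> (nat, 'k) mpol set" where
  "Ann_closure n W = {f \<in> pol_vars {0..n}. \<forall>F\<in>W. \<forall>w e.
     pairing f (\<lambda>u. if mdeg u = e then lookup F (bar u + w) else 0) = 0}"

lemma subspace_Ann_closure: "pm.subspace (Ann_closure n W)"
  by (rule pm.subspaceI)
     (auto simp: Ann_closure_def pairing_add pairing_pm_scale pm.subspace_0[OF subspace_pol_vars]
        pm.subspace_scale[OF subspace_pol_vars] pm.subspace_add[OF subspace_pol_vars])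

lemma pol_vars_mult:
  fixes p q :: "('v, 'k::field) mpol"
  assumes "p \<in> pol_vars X" "q \<in> pol_vars X"
  shows "p * q \<in> pol_vars X"
  unfolding pol_vars_def
proof (intro CollectI ballI)
  fix u assume "u \<in> keys (p * q)"
  then obtain a b where "a \<in> keys p" "b \<in> keys q" "u = a + b"
    using keys_mult[of p q] by blast
  thus "keys u \<subseteq> X" using assms by (auto simp: pol_vars_def keys_add_expo)
qed

lemma pol_deg_mult:
  fixes p q :: "('v, 'k::field) mpol"
  assumes "p \<in> pol_deg X d" "q \<in> pol_deg X e"
  shows "p * q \<in> pol_deg X (d + e)"
  unfolding pol_deg_eq
proof (intro CollectI ballI)
  fix u assume "u \<in> keys (p * q)"
  then obtain a b where "a \<in> keys p" "b \<in> keys q" "u = a + b"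
    using keys_mult[of p q] by blast
  thus "keys u \<subseteq> X \<and> mdeg u = d + e" using assms by (auto simp: pol_deg_eq keys_add_expo mdeg_add)
qed

text \<open>Multiplying by the monomial \<open>v\<close> turns the test with parameters
  \<open>w\<close>, \<open>e\<close> into the test with \<open>bar v + w\<close>,
  \<open>e - mdeg v\<close>, which is again among the defining ones; if \<open>mdeg v > e\<close>,
  the test is vacuous.\<close>

lemma single_mult_Ann_closure:
  assumes "f \<in> Ann_closure n W" "keys v \<subseteq> {0..n}"
  shows "single v c * f \<in> Ann_closure n W"
proof -
  have "single v c \<in> pol_vars {0..n}" using assms(2) by (auto simp: pol_vars_def)
  hence "single v c * f \<in> pol_vars {0..n}"
    using assms(1) by (intro pol_vars_mult) (auto simp: Ann_closure_def)
  moreover have "pairing (single v c * f) (\<lambda>u. if mdeg u = e then lookup F (bar u + w) else 0) = 0"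
    if F: "F \<in> W" for F w e
  proof (cases "mdeg v \<le> e")
    case True
    have "pairing f (\<lambda>u. if mdeg (v + u) = e then lookup F (bar (v + u) + w) else 0)
      = pairing f (\<lambda>u. if mdeg u = e - mdeg v then lookup F (bar u + (bar v + w)) else 0)"
      by (rule pairing_cong) (use True in \<open>auto simp: mdeg_add bar_add add_ac\<close>)
    also have "\<dots> = 0" using assms(1) F by (auto simp: Ann_closure_def)
    finally show ?thesis by (simp add: pairing_single_mult)
  next
    case False
    have "pairing f (\<lambda>u. if mdeg (v + u) = e then lookup F (bar (v + u) + w) else 0)
      = pairing f (\<lambda>u. 0)"
      by (rule pairing_cong) (use False in \<open>auto simp: mdeg_add\<close>)
    thus ?thesis by (simp add: pairing_single_mult)
  qed
  ultimately show ?thesis by (auto simp: Ann_closure_def)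
qed

lemma hom_ideal_Ann_closure: "hom_ideal n (Ann_closure n W)"
  unfolding hom_ideal_def
proof (intro conjI ballI allI)
  show "Ann_closure n W \<subseteq> pol_vars {0..n}" by (auto simp: Ann_closure_def)
  show "0 \<in> Ann_closure n W" by (rule pm.subspace_0[OF subspace_Ann_closure])
  show "f + g \<in> Ann_closure n W" if "f \<in> Ann_closure n W" "g \<in> Ann_closure n W" for f g
    using that by (rule pm.subspace_add[OF subspace_Ann_closure])
next
  fix f g :: "(nat, 'a) mpol" assume f: "f \<in> Ann_closure n W" and g: "g \<in> pol_vars {0..n}"
  have "g * f = (\<Sum>v\<in>keys g. single v (lookup g v) * f)"
    by (subst sum_single_keys[of g, symmetric]) (simp add: sum_distrib_right)
  also have "\<dots> \<in> Ann_closure n W"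
    using g by (intro pm.subspace_sum[OF subspace_Ann_closure] single_mult_Ann_closure[OF f])
       (auto simp: pol_vars_def)
  finally show "g * f \<in> Ann_closure n W" .
next
  fix f d assume f: "f \<in> Ann_closure n W"
  \<comment> \<open>The defining tests look at one degree \<open>e\<close> at a time: taking the
    component of degree \<open>d\<close> leaves the tests with \<open>e = d\<close> unchanged and
    turns all others into 0.\<close>
  have "pairing (hom_comp d f) h = pairing f (\<lambda>u. if mdeg u = d then h u else 0)" for h
  proof -
    have "pairing (hom_comp d f) h = (\<Sum>u\<in>keys f. lookup (hom_comp d f) u * h u)"
      by (rule pairing_superset) (auto simp: keys_hom_comp)
    also have "\<dots> = pairing f (\<lambda>u. if mdeg u = d then h u else 0)"
      unfolding pairing_def by (rule sum.cong) (auto simp: lookup_hom_comp)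
    finally show ?thesis .
  qed
  moreover have "pairing f (\<lambda>u. if mdeg u = d then if mdeg u = e then lookup F (bar u + w) else 0 else 0) = 0"
    if "F \<in> W" for F w e
  proof (cases "d = e")
    case True
    hence "(\<lambda>u. if mdeg u = d then if mdeg u = e then lookup F (bar u + w) else 0 else 0)
      = (\<lambda>u. if mdeg u = e then lookup F (bar u + w) else 0)" by auto
    thus ?thesis using f that by (simp add: Ann_closure_def)
  next
    case False
    hence "(\<lambda>u. if mdeg u = d then if mdeg u = e then lookup F (bar u + w) else 0 else 0) = (\<lambda>u. 0)"
      by auto
    thus ?thesis by simp
  qed
  ultimately show "hom_comp d f \<in> Ann_closure n W"
    using f by (auto simp: Ann_closure_def pol_vars_def keys_hom_comp)
qed

text \<open>A power of \<alpha>_0 is invisible to \<open>bar\<close> and only shifts the degree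
  \<open>e\<close> of a test. Hence \<alpha>_0 is a nonzerodivisor modulo the ideal, so the single
  multiplier \<alpha>_0^m suffices; geometrically, nothing lies on the hyperplane at
  infinity.\<close>

lemma saturated_Ann_closure: "saturated n (Ann_closure n W)"
  unfolding saturated_def
proof (intro ballI impI)
  fix f :: "(nat, 'a) mpol"
  assume f: "f \<in> pol_vars {0..n}" and "\<exists>m. \<forall>g\<in>pol_deg {0..n} m. g * f \<in> Ann_closure n W"
  then obtain m where m: "\<And>g. g \<in> pol_deg {0..n} m \<Longrightarrow> g * f \<in> Ann_closure n W" by blast
  have x: "single (single 0 m) 1 * f \<in> Ann_closure n W"
    by (rule m) (auto simp: pol_deg_eq)
  have "pairing f (\<lambda>u. if mdeg u = e then lookup F (bar u + w) else 0) = 0" if F: "F \<in> W" for F w e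
  proof -
    have "pairing (single (single 0 m) 1 * f) (\<lambda>u. if mdeg u = e + m then lookup F (bar u + w) else 0) = 0"
      using x F by (auto simp: Ann_closure_def)
    moreover have "(\<lambda>u. if mdeg (single 0 m + u) = e + m then lookup F (bar (single 0 m + u) + w) else 0)
       = (\<lambda>u. if mdeg u = e then lookup F (bar u + w) else 0)"
      by (auto simp: mdeg_add bar_add fun_eq_iff)
    ultimately show ?thesis by (simp add: pairing_single_mult)
  qed
  thus "f \<in> Ann_closure n W" using f by (auto simp: Ann_closure_def)
qed

section \<open>The Hilbert function of the closure\<close>

lemma high_degree_in_Ann:
  assumes "W \<subseteq> pol_deg_le {1..n} d" "\<theta> \<in> pol_vars {1..n}" "\<And>u. u \<in> keys \<theta> \<Longrightarrow> mdeg u > d"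
  shows "\<theta> \<in> Ann n W"
  unfolding Ann_iff
proof (intro conjI ballI allI)
  fix F w assume "F \<in> W"
  hence F: "F \<in> pol_deg_le {1..n} d" using assms(1) by auto
  have "pairing \<theta> (\<lambda>u. lookup F (u + w)) = pairing \<theta> (\<lambda>u. 0)"
  proof (rule pairing_cong)
    fix u assume "u \<in> keys \<theta>"
    hence "mdeg (u + w) > d" using assms(3)[of u] by (simp add: mdeg_add)
    thus "lookup F (u + w) = 0" using pol_deg_leD[OF F, of "u + w"] by (force simp: in_keys_iff)
  qed
  thus "pairing \<theta> (\<lambda>u. lookup F (u + w)) = 0" by simp
qed (fact assms(2))

lemma mod_Ann_low_degree:
  assumes W: "W \<subseteq> pol_deg_le {1..n} d" and \<theta>: "\<theta> \<in> pol_vars {1..n}"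
  obtains \<theta>' where "\<theta>' \<in> pol_deg_le {1..n} d" "\<theta> - \<theta>' \<in> Ann n W"
proof -
  define \<theta>' where "\<theta>' = (\<Sum>i\<le>d. hom_comp i \<theta>)"
  have l: "lookup \<theta>' u = (if mdeg u \<le> d then lookup \<theta> u else 0)" for u
    by (simp add: \<theta>'_def lookup_sum lookup_hom_comp)
  have "\<theta>' \<in> pol_deg_le {1..n} d"
    using \<theta> by (auto simp: pol_deg_le_def pol_vars_def in_keys_iff l split: if_splits)
  moreover have "\<theta> - \<theta>' \<in> Ann n W"
    by (rule high_degree_in_Ann[OF W])
       (use \<theta> in \<open>auto simp: pol_vars_def in_keys_iff l lookup_minus split: if_splits\<close>)
  ultimately show ?thesis using that by blast
qed

lemma dehomogenize_homogenize:
  assumes "\<theta> \<in> pol_deg_le {1..n} d"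
  shows "dehomogenize (homogenize e \<theta>) = \<theta>"
proof (rule poly_mapping_eqI)
  fix u
  have "lookup (dehomogenize (homogenize e \<theta>)) u
    = pairing \<theta> (\<lambda>v. if bar (homogenize_expo e v) = u then 1 else 0)"
    by (simp add: dehomogenize_def homogenize_def lookup_pushforward pairing_pushforward)
  also have "\<dots> = pairing \<theta> (\<lambda>v. if v = u then 1 else 0)"
    by (rule pairing_cong) (use pol_deg_leD[OF assms] in \<open>auto simp: bar_homogenize_expo\<close>)
  finally show "lookup (dehomogenize (homogenize e \<theta>)) u = lookup \<theta> u"
    by (simp add: lookup_eq_pairing)
qed

lemma dehomogenize_in_pol_vars:
  assumes "f \<in> pol_vars {0..n}"
  shows "dehomogenize f \<in> pol_vars {1..n}"
  unfolding pol_vars_def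
proof (intro CollectI ballI)
  fix u assume "u \<in> keys (dehomogenize f)"
  then obtain v where "v \<in> keys f" "u = bar v"
    using keys_pushforward[of bar f] unfolding dehomogenize_def by auto
  thus "keys u \<subseteq> {1..n}"
    using assms by (force simp: pol_vars_def keys_bar)
qed

lemma Ann_closure_iff_form:
  assumes "f \<in> pol_deg {0..n} e"
  shows "f \<in> Ann_closure n W \<longleftrightarrow> dehomogenize f \<in> Ann n W"
proof -
  have deg: "mdeg u = e" if "u \<in> keys f" for u
    using assms that by (auto simp: pol_deg_def)
  have f: "f \<in> pol_vars {0..n}" using assms by (auto simp: pol_deg_def)
  have "pairing f (\<lambda>u. if mdeg u = e' then lookup F (bar u + w) else 0)
    = (if e' = e then pairing f (\<lambda>u. lookup F (bar u + w)) else 0)" for F w e'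
  proof -
    have "pairing f (\<lambda>u. if mdeg u = e' then lookup F (bar u + w) else 0)
      = pairing f (\<lambda>u. if e' = e then lookup F (bar u + w) else 0)"
      by (rule pairing_cong) (auto simp: deg)
    thus ?thesis by auto
  qed
  thus ?thesis
    using f dehomogenize_in_pol_vars[OF f]
    by (auto simp: Ann_closure_def Ann_iff dehomogenize_def pairing_pushforward)
qed

text \<open>Dehomogenization maps the forms of degree \<open>e\<close> to \<open>S*\<close> with
  \<open>Ann_closure\<close> as preimage of \<open>Ann n W\<close>. It is surjective modulo the
  annihilator once \<open>e\<close> is at least \<open>d\<close>, because each class has a
  representative of degree at most \<open>d\<close>, which can be homogenized to degree
  \<open>e\<close>. The Hilbert function is therefore constant from degree \<open>d\<close>
  on.\<close>

lemma quot_dim_Ann_closure: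
  fixes W :: "'k::field dpol set"
  assumes W: "W \<subseteq> pol_deg_le {1..n} d" and e: "d \<le> e"
  shows "quot_dim (pol_deg {0..n} e) (Ann_closure n W \<inter> pol_deg {0..n} e)
    = quot_dim (pol_vars {1..n}) (Ann n W)"
proof -
  obtain g :: "(nat, 'k) mpol \<Rightarrow> (nat, 'k) mpol" where g: "pm_linear g" "\<And>x. g x = 0 \<longleftrightarrow> x \<in> Ann n W"
    using pm_linear_with_kernel[OF subspace_Ann] by blast
  interpret g: Vector_Spaces.linear pm_scale pm_scale g by (rule g(1))
  have lin: "pm_linear (\<lambda>f. g (dehomogenize f))"
    unfolding dehomogenize_def by (rule pm_linear_compose[OF pm_linear_pushforward g(1)])
  have "quot_dim (pol_deg {0..n} e) (Ann_closure n W \<inter> pol_deg {0..n} e)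
    = pm.dim ((\<lambda>f. g (dehomogenize f)) ` pol_deg {0..n} e)"
    by (rule quot_dim_eq_dim_image[OF subspace_pol_deg _ lin])
       (auto simp: g(2) Ann_closure_iff_form intro!: pm.subspace_inter subspace_Ann_closure subspace_pol_deg)
  also have "(\<lambda>f. g (dehomogenize f)) ` pol_deg {0..n} e = g ` pol_vars {1..n}"
  proof (intro equalityI subsetI)
    fix y assume "y \<in> (\<lambda>f. g (dehomogenize f)) ` pol_deg {0..n} e"
    then obtain f where "f \<in> pol_deg {0..n} e" "y = g (dehomogenize f)" by blast
    thus "y \<in> g ` pol_vars {1..n}"
      using dehomogenize_in_pol_vars[of f n] by (simp add: pol_deg_def)
  next
    fix y assume "y \<in> g ` pol_vars {1..n}"
    then obtain \<theta> where \<theta>: "\<theta> \<in> pol_vars {1..n}" "y = g \<theta>" by auto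
    obtain \<theta>' where \<theta>': "\<theta>' \<in> pol_deg_le {1..n} d" "\<theta> - \<theta>' \<in> Ann n W"
      using mod_Ann_low_degree[OF W \<theta>(1)] by blast
    have "g \<theta>' = y" using \<theta>'(2) g(2)[of "\<theta> - \<theta>'"] \<theta>(2) by (simp add: g.diff)
    thus "y \<in> (\<lambda>f. g (dehomogenize f)) ` pol_deg {0..n} e"
      using dehomogenize_homogenize[OF \<theta>'(1)] homogenize_in_pol_deg[OF \<theta>'(1) e]
      by (intro image_eqI[of _ _ "homogenize e \<theta>'"]) simp_all
  qed
  also have "pm.dim (g ` pol_vars {1..n}) = quot_dim (pol_vars {1..n}) (Ann n W)"
    by (rule quot_dim_eq_dim_image[symmetric, OF subspace_pol_vars subspace_Ann g(1)]) (rule g(2))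
  finally show ?thesis .
qed

section \<open>The Hilbert function of a saturated ideal\<close>

text \<open>
  If \<open>f = \<Sum>\<^sub>i t\<^sup>i \<alpha>\<^sub>i\<close> killed some nonzero \<open>v\<close> in \<open>(T*/I)[t]\<close>, comparing lowest coefficients in \<open>t\<close> shows that
  a power of \<open>\<alpha>\<^sub>0\<close> kills \<open>v\<close>; replacing \<open>v\<close> by a suitable \<open>\<alpha>\<^sub>0\<^sup>N v\<close> one gets \<open>\<alpha>\<^sub>0 v = 0\<close>, and the argument continues with
  \<open>\<alpha>\<^sub>1, \<dots>, \<alpha>\<^sub>n\<close> until \<open>v\<close> is killed by all variables, which saturation forbids. Working over the polynomial ring in \<open>t\<close>
  replaces the usual choice of a general linear form.
\<close>

definition var :: "nat \<Rightarrow> (nat, 'k::field) mpol" where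
  "var i = single (single i 1) 1"

definition generic_form :: "nat \<Rightarrow> (nat, 'k::field) mpol poly" where
  "generic_form n = (\<Sum>i\<le>n. monom (var i) i)"

lemma coeff_generic_form: "coeff (generic_form n) i = (if i \<le> n then var i else 0)"
  by (simp add: generic_form_def coeff_sum)

lemma var_in_pol_deg: "i \<in> X \<Longrightarrow> var i \<in> pol_deg X 1"
  by (auto simp: var_def pol_deg_eq)

lemma var_in_pol_vars: "i \<in> X \<Longrightarrow> var i \<in> pol_vars X"
  by (auto simp: var_def pol_vars_def)

lemma hom_idealD:
  assumes "hom_ideal n I"
  shows "I \<subseteq> pol_vars {0..n}" "pm.subspace I"
    "f \<in> I \<Longrightarrow> g \<in> pol_vars {0..n} \<Longrightarrow> g * f \<in> I"
proof -
  show I: "I \<subseteq> pol_vars {0..n}"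
    and mult: "f \<in> I \<Longrightarrow> g \<in> pol_vars {0..n} \<Longrightarrow> g * f \<in> I" for f g
    using assms by (auto simp: hom_ideal_def)
  show "pm.subspace I"
    by (rule pm.subspaceI)
       (use assms in \<open>auto simp: hom_ideal_def pm_scale_eq_mult intro!: mult, auto simp: pol_vars_def\<close>)
qed

text \<open>Saturation in the form used below, with multipliers of degree 1: an exponent of degree 1
  is a single variable, so the variables generate all linear forms.\<close>

lemma saturated_var:
  assumes I: "hom_ideal n I" "saturated n I" and f: "f \<in> pol_vars {0..n}"
    and var: "\<And>i. i \<le> n \<Longrightarrow> var i * f \<in> I"
  shows "f \<in> I"
proof -
  have "g * f \<in> I" if g: "g \<in> pol_deg {0..n} 1" for g
  proof -
    have "single u c * f \<in> I" if u: "u \<in> keys g" for u c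
    proof -
      have "keys u \<subseteq> {0..n}" "mdeg u = 1" using u g by (auto simp: pol_deg_eq)
      then obtain i where i: "i \<in> keys u"
        by (metis equals0I mdeg_def sum.empty zero_neq_one)
      have eq: "(\<Sum>j\<in>keys u. lookup u j) = 1" using \<open>mdeg u = 1\<close> by (simp add: mdeg_def)
      have "lookup u j = (if j = i then 1 else 0)" for j
      proof -
        have "(\<Sum>j\<in>keys u. lookup u j) = lookup u i + (\<Sum>j\<in>keys u - {i}. lookup u j)"
          using i by (simp add: sum.remove)
        moreover have "lookup u i \<noteq> 0" using i by (simp add: in_keys_iff)
        ultimately have *: "lookup u i = 1" "(\<Sum>j\<in>keys u - {i}. lookup u j) = 0"
          using eq by linarith+
        show ?thesis
        proof (cases "j \<in> keys u - {i}")
          case True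
          have "lookup u j \<le> (\<Sum>j\<in>keys u - {i}. lookup u j)"
            by (rule member_le_sum[OF True]) auto
          thus ?thesis using True * by simp
        qed (use * in \<open>auto simp: in_keys_iff\<close>)
      qed
      hence "u = single i 1" by (intro poly_mapping_eqI) (simp add: lookup_single when_def)
      hence "single u c * f = single 0 c * (var i * f)"
        by (simp add: var_def mult_single flip: mult.assoc)
      moreover have "i \<le> n" using i \<open>keys u \<subseteq> _\<close> by auto
      moreover have "single 0 c \<in> pol_vars {0..n}" by (auto simp: pol_vars_def)
      ultimately show ?thesis
        using hom_idealD(3)[OF I(1) var] by metis
    qed
    hence "(\<Sum>u\<in>keys g. single u (lookup g u) * f) \<in> I"
      by (intro pm.subspace_sum[OF hom_idealD(2)[OF I(1)]]) auto
    thus ?thesis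
      by (simp add: sum_single_keys flip: sum_distrib_right)
  qed
  thus ?thesis using I(2) f unfolding saturated_def by blast
qed

lemma generic_form_nonzerodivisor:
  assumes I: "hom_ideal n I" "saturated n I"
    and v: "\<And>j. coeff v j \<in> pol_vars {0..n}"
    and gv: "\<And>j. coeff (generic_form n * v) j \<in> I"
  shows "coeff v j \<in> I"
proof (rule ccontr)
  note sub = hom_idealD(2)[OF I(1)]
  note mul = hom_idealD(3)[OF I(1)]
  assume nv: "coeff v j \<notin> I"
  have "\<exists>w. (\<forall>j. coeff w j \<in> pol_vars {0..n}) \<and> (\<forall>j. coeff (generic_form n * w) j \<in> I) \<and>
     (\<exists>j. coeff w j \<notin> I) \<and> (\<forall>i<k. \<forall>j. var i * coeff w j \<in> I)" if "k \<le> Suc n" for k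
    using that
  proof (induction k)
    case 0
    show ?case using v gv nv by auto
  next
    case (Suc k)
    then obtain w where w: "\<And>j. coeff w j \<in> pol_vars {0..n}" "\<And>j. coeff (generic_form n * w) j \<in> I"
      "\<exists>j. coeff w j \<notin> I" "\<And>i j. i < k \<Longrightarrow> var i * coeff w j \<in> I"
      by (metis Suc_leD)
    have k: "k \<le> n" using Suc.prems by simp
    have vark: "var k ^ m \<in> pol_vars {0..n}" for m
    proof (induction m)
      case 0
      show ?case by (auto simp: pol_vars_def)
    next
      case (Suc m)
      thus ?case using pol_vars_mult[OF var_in_pol_vars[of k "{0..n}"] Suc] k by simp
    qed
    \<comment> \<open>In the coefficient of t^(j+k) of the product, the terms with
      \<open>i < k\<close> lie in \<open>I\<close> because \<alpha>_i already kills
      \<open>w\<close>. The terms with \<open>i > k\<close> involve coefficients of \<open>w\<close>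
      of index below \<open>j\<close>, which \<alpha>_k^j kills by induction. What remains is
      \<alpha>_k times \<open>coeff w j\<close>.\<close>
    have nil: "var k ^ Suc j * coeff w j \<in> I" for j
    proof (induction j rule: less_induct)
      case (less j)
      let ?a = "\<lambda>i. coeff (generic_form n) i :: (nat, 'a) mpol"
      have a: "?a i \<in> pol_vars {0..n}" for i
        by (auto simp: coeff_generic_form var_in_pol_vars pm.subspace_0[OF subspace_pol_vars])
      have "(\<Sum>i\<le>j + k. ?a i * coeff w (j + k - i)) \<in> I"
        using w(2)[of "j + k"] by (simp add: coeff_mult)
      also have "(\<Sum>i\<le>j + k. ?a i * coeff w (j + k - i)) =
        ?a k * coeff w j + (\<Sum>i\<in>{..j + k} - {k}. ?a i * coeff w (j + k - i))"
        by (subst sum.remove[of _ k]) auto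
      finally have sum_in: "var k ^ j * (?a k * coeff w j + (\<Sum>i\<in>{..j + k} - {k}. ?a i * coeff w (j + k - i))) \<in> I"
        by (rule mul[OF _ vark])
      have rest_in: "var k ^ j * (\<Sum>i\<in>{..j + k} - {k}. ?a i * coeff w (j + k - i)) \<in> I"
        unfolding sum_distrib_left
      proof (rule pm.subspace_sum[OF sub])
        fix i assume i: "i \<in> {..j + k} - {k}"
        show "var k ^ j * (?a i * coeff w (j + k - i)) \<in> I"
        proof (cases "i < k")
          case True
          thus ?thesis using mul[OF w(4)[OF True] vark] k by (simp add: coeff_generic_form)
        next
          case False
          hence ik: "j + k - i < j" using i by auto
          have "var k ^ (j - Suc (j + k - i)) * ?a i * (var k ^ Suc (j + k - i) * coeff w (j + k - i)) \<in> I"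
            by (intro mul less[OF ik] pol_vars_mult vark a)
          moreover have "(var k :: (nat, 'a) mpol) ^ j = var k ^ (j - Suc (j + k - i)) * var k ^ Suc (j + k - i)"
            using ik by (subst power_add[symmetric]) simp
          ultimately show ?thesis by (simp only: mult_ac)
        qed
      qed
      have "var k ^ j * (?a k * coeff w j) \<in> I"
        using pm.subspace_diff[OF sub sum_in rest_in] by (simp only: distrib_left add_diff_cancel_right')
      thus ?case using k by (simp add: coeff_generic_form mult_ac)
    qed
    \<comment> \<open>One exponent serves all coefficients at once, since \<open>w\<close> has only
      finitely many nonzero ones.\<close>
    have "\<exists>m. \<forall>j. var k ^ m * coeff w j \<in> I"
    proof (intro exI allI)
      fix j
      show "var k ^ Suc (degree w) * coeff w j \<in> I"
      proof (cases "j \<le> degree w")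
        case True
        have "var k ^ (degree w - j) * (var k ^ Suc j * coeff w j) \<in> I"
          by (rule mul[OF nil vark])
        moreover have "(var k :: (nat, 'a) mpol) ^ Suc (degree w) = var k ^ (degree w - j) * var k ^ Suc j"
          using True by (subst power_add[symmetric]) (simp add: Suc_diff_le)
        ultimately show ?thesis by (simp only: mult.assoc)
      next
        case False
        thus ?thesis by (simp add: coeff_eq_0 pm.subspace_0[OF sub])
      qed
    qed
    then obtain m where m: "\<forall>j. var k ^ m * coeff w j \<in> I"
      and least: "\<And>m'. m' < m \<Longrightarrow> \<not> (\<forall>j. var k ^ m' * coeff w j \<in> I)"
      using exists_least_iff[of "\<lambda>m. \<forall>j. var k ^ m * coeff w j \<in> I"] by blast
    have "m \<noteq> 0" using w(3) m by (metis mult_1 power_0)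
    then obtain m' where m': "m = Suc m'" using not0_implies_Suc by blast
    \<comment> \<open>As \<open>m\<close> is minimal and positive, \<alpha>_k^(m-1) w is still
      nonzero modulo \<open>I\<close>, but is now killed by \<alpha>_k as well.\<close>
    define w' where "w' = smult (var k ^ m') w"
    have "coeff (generic_form n * w') j = var k ^ m' * coeff (generic_form n * w) j" for j
      by (simp add: w'_def)
    hence "coeff (generic_form n * w') j \<in> I" for j
      using mul[OF w(2) vark] by simp
    moreover have "coeff w' j \<in> pol_vars {0..n}" for j
      by (simp add: w'_def pol_vars_mult vark w(1))
    moreover have "\<exists>j. coeff w' j \<notin> I"
      using least[of m'] m' by (simp add: w'_def)
    moreover have "var i * coeff w' j \<in> I" if "i < Suc k" for i j
    proof (cases "i = k")
      case True
      thus ?thesis using m m' by (simp add: w'_def mult.assoc)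
    next
      case False
      hence "var k ^ m' * (var i * coeff w j) \<in> I" using that by (intro mul vark w(4)) auto
      thus ?thesis by (simp add: w'_def mult_ac)
    qed
    ultimately show ?case by blast
  qed
  from this[OF order_refl] obtain w where
    w: "\<And>j. coeff w j \<in> pol_vars {0..n}" "\<exists>j. coeff w j \<notin> I"
      "\<And>i j. i < Suc n \<Longrightarrow> var i * coeff w j \<in> I" by blast
  have "coeff w j \<in> I" for j
    by (rule saturated_var[OF I w(1)]) (simp add: w(3))
  with w(2) show False by blast
qed

lemma generic_form_power_nonzerodivisor:
  assumes I: "hom_ideal n I" "saturated n I"
    and v: "\<And>j. coeff v j \<in> pol_vars {0..n}"
    and gv: "\<And>j. coeff (generic_form n ^ m * v) j \<in> I"
  shows "coeff v j \<in> I"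
  using v gv
proof (induction m arbitrary: v j)
  case 0
  thus ?case by simp
next
  case (Suc m)
  have "coeff (generic_form n * v) j \<in> pol_vars {0..n}" for j
    unfolding coeff_mult
    by (intro pm.subspace_sum[OF subspace_pol_vars] pol_vars_mult Suc.prems(1))
       (auto simp: coeff_generic_form var_in_pol_vars pm.subspace_0[OF subspace_pol_vars])
  hence "coeff (generic_form n * v) j \<in> I" for j
    by (rule Suc.IH) (use Suc.prems(2) in \<open>simp add: mult_ac\<close>)
  thus ?case by (rule generic_form_nonzerodivisor[OF I Suc.prems(1)])
qed

lemma coeff_generic_form_power: "coeff (generic_form n ^ m) j \<in> pol_deg {0..n} m"
proof (induction m arbitrary: j)
  case 0
  show ?case by (auto simp: pol_deg_eq coeff_1 split: if_splits)
next
  case (Suc m)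
  have "coeff (generic_form n) i \<in> (pol_deg {0..n} 1 :: (nat, 'a) mpol set)" for i
    using var_in_pol_deg[of i "{0..n}"]
    by (auto simp: coeff_generic_form pm.subspace_0[OF subspace_pol_deg])
  from pol_deg_mult[OF this Suc.IH]
  show ?case by (simp add: coeff_mult pm.subspace_sum[OF subspace_pol_deg])
qed

lemma pol_deg_eq_span: "pol_deg {0..n} d = pm.span ((\<lambda>u. single u 1) ` expos n d)"
proof
  show "pm.span ((\<lambda>u. single u 1) ` expos n d) \<subseteq> (pol_deg {0..n} d :: (nat, 'a) mpol set)"
    by (rule pm.span_minimal[OF _ subspace_pol_deg]) (auto simp: pol_deg_eq expos_def)
  show "pol_deg {0..n} d \<subseteq> pm.span ((\<lambda>u. single u 1 :: (nat, 'a) mpol) ` expos n d)"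
  proof
    fix p :: "(nat, 'a) mpol" assume p: "p \<in> pol_deg {0..n} d"
    have "single u c \<in> pm.span ((\<lambda>u. single u 1) ` expos n d)" if "u \<in> keys p" for u and c :: 'a
    proof -
      have "u \<in> expos n d" using that p by (simp add: pol_deg_eq expos_def)
      thus ?thesis
        unfolding single_eq_pm_scale[of u c]
        by (intro pm.span_scale pm.span_base imageI)
    qed
    hence "(\<Sum>u\<in>keys p. single u (lookup p u)) \<in> pm.span ((\<lambda>u. single u 1) ` expos n d)"
      by (intro pm.span_sum) auto
    thus "p \<in> pm.span ((\<lambda>u. single u 1) ` expos n d)" by (simp add: sum_single_keys)
  qed
qed

text \<open>This bounds the Hilbert function in every degree by its eventual value \<open>r\<close>.
  Multiplying the \<open>s + 1\<close> forms by a power of the generic form moves them to a degree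
  where the quotient has dimension \<open>r\<close>. There they become \<open>s + 1\<close> vectors
  over the polynomial ring in t with only \<open>r\<close> coordinates, hence are dependent. The
  generic form cancels modulo \<open>I\<close>, and any nonzero t-coefficient of the relation gives
  the scalars \<open>c\<close>.\<close>

lemma forms_dependent_mod_zero_dim:
  fixes I :: "(nat, 'k::field) mpol set"
  assumes I: "zero_dim_subscheme n r I" and s: "r \<le> s"
    and f: "\<And>b. b \<le> s \<Longrightarrow> f b \<in> pol_deg {0..n} i"
  obtains c where "(\<Sum>b\<le>s. pm_scale (c b) (f b)) \<in> I" "\<exists>b\<le>s. c b \<noteq> 0"
proof -
  have hI: "hom_ideal n I" and sI: "saturated n I"
    using I by (auto simp: zero_dim_subscheme_def)
  note sub = hom_idealD(2)[OF hI]
  obtain e0 where e0: "\<And>e. e \<ge> e0 \<Longrightarrow> quot_dim (pol_deg {0..n} e) (I \<inter> pol_deg {0..n} e) = r"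
    using I by (auto simp: zero_dim_subscheme_def)
  \<comment> \<open>Large enough both to be reached from degree \<open>i\<close> by multiplication
    and to have Hilbert function value \<open>r\<close>.\<close>
  define e where "e = max i e0"
  define m where "m = e - i"
  have e: "e = m + i" "quot_dim (pol_deg {0..n} e) (I \<inter> pol_deg {0..n} e) = r"
    by (auto simp: e_def m_def intro!: e0)
  obtain g :: "(nat, 'k) mpol \<Rightarrow> (nat, 'k) mpol" where g: "pm_linear g" "\<And>x. g x = 0 \<longleftrightarrow> x \<in> I"
    using pm_linear_with_kernel[OF sub] by blast
  interpret g: Vector_Spaces.linear pm_scale pm_scale g by (rule g(1))
  have "pm.dim (g ` pol_deg {0..n} e) = r"
    using quot_dim_eq_dim_image[OF subspace_pol_deg pm.subspace_inter[OF sub subspace_pol_deg] g(1)] g(2) e(2)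
    by auto
  then obtain B where B: "B \<subseteq> g ` pol_deg {0..n} e" "pm.independent B" "g ` pol_deg {0..n} e \<subseteq> pm.span B" "card B = r"
    by (metis pm.basis_exists)
  have "B \<subseteq> pm.span (g ` (\<lambda>u. single u 1) ` expos n e)"
    using B(1) unfolding g.span_image by (simp add: pol_deg_eq_span)
  hence finB: "finite B"
    by (rule pm.independent_span_bound[OF _ B(2), THEN conjunct1, rotated])
       (intro finite_imageI finite_expos)
  then obtain bl where bl: "set bl = B" "distinct bl" using finite_distinct_list by blast
  have len: "length bl = r" using bl B(4) distinct_card by fastforce
  \<comment> \<open>Coordinates modulo \<open>I\<close> in degree \<open>e\<close>, padded by zeros
    beyond the \<open>r\<close>-th so that the matrix \<open>A\<close> below is square; since
    \<open>r \<le> s\<close>, its last row vanishes.\<close>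
  define \<xi> where "\<xi> q x = (if q < r then pm.representation B (g x) (bl ! q) else 0)" for q x
  have \<xi>_sum: "\<xi> q (\<Sum>a\<in>A. pm_scale (c a) (x a)) = (\<Sum>a\<in>A. c a * \<xi> q (x a))"
    if "\<And>a. a \<in> A \<Longrightarrow> x a \<in> pol_deg {0..n} e" for q A x and c :: "nat \<times> nat \<Rightarrow> 'k"
  proof -
    have "g (x a) \<in> pm.span B" if "a \<in> A" for a using \<open>\<And>a. a \<in> A \<Longrightarrow> _\<close>[OF that] B(3) by auto
    thus ?thesis
      unfolding \<xi>_def g.sum g.scale
      by (auto simp: pm.representation_sum[OF B(2)] pm.span_scale pm.representation_scale[OF B(2)])
  qed
  have \<xi>_zero: "x \<in> I" if "x \<in> pol_deg {0..n} e" "\<And>q. q < r \<Longrightarrow> \<xi> q x = 0" for x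
  proof -
    have "pm.representation B (g x) b = 0" for b
    proof (cases "b \<in> B")
      case True
      then obtain q where "q < r" "b = bl ! q" using bl(1) len by (metis in_set_conv_nth)
      thus ?thesis using that(2)[of q] by (simp add: \<xi>_def)
    next
      case False
      thus ?thesis using pm.representation_ne_zero by blast
    qed
    moreover have "g x \<in> pm.span B" using that(1) B(3) by auto
    ultimately have "g x = 0"
      using pm.sum_nonzero_representation_eq[OF B(2), of "g x"] by simp
    thus ?thesis using g(2) by simp
  qed
  have \<xi>0: "\<xi> q 0 = 0" for q by (simp add: \<xi>_def pm.representation_zero)
  define G where "G b = generic_form n ^ m * [:f b:]" for b
  have G: "coeff (G b) l \<in> pol_deg {0..n} e" if "b \<le> s" for b l
    unfolding e(1) G_def using pol_deg_mult[OF coeff_generic_form_power[of n m l] f[OF that]]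
    by (simp add: mult.commute)
  define A where "A = mat (Suc s) (Suc s) (\<lambda>(q, b). map_poly (\<xi> q) (G b))"
  have A: "A \<in> carrier_mat (Suc s) (Suc s)" by (simp add: A_def)
  have "row A s = 0\<^sub>v (Suc s)"
    using s by (intro eq_vecI) (auto simp: A_def \<xi>_def intro!: poly_eqI simp: coeff_map_poly)
  hence "det A = 0"
    by (subst laplace_expansion_row[OF A, of s])
       (auto intro!: sum.neutral simp: index_row(1)[symmetric] A_def simp del: index_row)
  \<comment> \<open>The polynomial ring in t is an integral domain, so a singular matrix over it has
    a nonzero kernel vector with polynomial entries.\<close>
  then obtain v where v: "v \<in> carrier_vec (Suc s)" "v \<noteq> 0\<^sub>v (Suc s)" "A *\<^sub>v v = 0\<^sub>v (Suc s)"
    using det_0_iff_vec_prod_zero[OF A] by blast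
  \<comment> \<open>The entries of \<open>v\<close> with their scalars turned into constants of
    \<open>T*\<close>, so that they can be multiplied with forms.\<close>
  define C where "C b = map_poly (single (0 :: nat expo)) (v $ b)" for b
  have C: "coeff (C b) l = single 0 (coeff (v $ b) l)" for b l
    by (simp add: C_def coeff_map_poly)
  define V where "V = (\<Sum>b\<le>s. [:f b:] * C b)"
  have coeff_V: "coeff V l = (\<Sum>b\<le>s. pm_scale (coeff (v $ b) l) (f b))" for l
    by (simp add: V_def coeff_sum C pm_scale_eq_mult mult_ac)
  have "coeff (generic_form n ^ m * V) l \<in> I" for l
  proof -
    have "generic_form n ^ m * V = (\<Sum>b\<le>s. C b * G b)"
      by (simp add: V_def G_def sum_distrib_left mult_ac)
    hence eq: "coeff (generic_form n ^ m * V) l =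
        (\<Sum>a\<in>{..s} \<times> {..l}. pm_scale (coeff (v $ fst a) (snd a)) (coeff (G (fst a)) (l - snd a)))"
      by (simp add: coeff_sum coeff_mult C pm_scale_eq_mult sum.cartesian_product case_prod_beta)
    have "\<xi> q (coeff (generic_form n ^ m * V) l) = 0" if q: "q < r" for q
    proof -
      have "0 = (A *\<^sub>v v) $ q" using v(3) q s by simp
      also have "\<dots> = (\<Sum>b\<le>s. map_poly (\<xi> q) (G b) * v $ b)"
        using q s v(1) by (auto simp: A_def scalar_prod_def atLeast0LessThan lessThan_Suc_atMost intro!: sum.cong)
      finally have "0 = coeff (\<Sum>b\<le>s. v $ b * map_poly (\<xi> q) (G b)) l" by (simp add: mult_ac)
      also have "\<dots> = (\<Sum>a\<in>{..s} \<times> {..l}. coeff (v $ fst a) (snd a) * \<xi> q (coeff (G (fst a)) (l - snd a)))"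
        by (simp add: coeff_sum coeff_mult coeff_map_poly \<xi>0 sum.cartesian_product case_prod_beta)
      also have "\<dots> = \<xi> q (coeff (generic_form n ^ m * V) l)"
        unfolding eq by (rule \<xi>_sum[symmetric]) (auto intro: G)
      finally show ?thesis by simp
    qed
    moreover have "coeff (generic_form n ^ m * V) l \<in> pol_deg {0..n} e"
      unfolding eq by (intro pm.subspace_sum[OF subspace_pol_deg] pm.subspace_scale[OF subspace_pol_deg] G) auto
    ultimately show ?thesis by (intro \<xi>_zero) auto
  qed
  moreover have "coeff V l \<in> pol_vars {0..n}" for l
    unfolding coeff_V
    by (intro pm.subspace_sum[OF subspace_pol_vars] pm.subspace_scale[OF subspace_pol_vars])
       (use f in \<open>auto simp: pol_deg_def\<close>)
  ultimately have VI: "coeff V l \<in> I" for l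
    by (intro generic_form_power_nonzerodivisor[OF hI sI, of V m])
  \<comment> \<open>All t-coefficients of \<open>V\<close> lie in \<open>I\<close>, so one at which
    some entry of \<open>v\<close> is nonzero gives a nontrivial relation.\<close>
  obtain b where b: "b < Suc s" "v $ b \<noteq> 0"
    using v(1,2) by (metis carrier_vecD eq_vecI index_zero_vec(1) index_zero_vec(2))
  then obtain l where l: "coeff (v $ b) l \<noteq> 0" by (metis coeff_0 poly_eqI)
  show ?thesis
    by (rule that[of "\<lambda>b. coeff (v $ b) l"]) (use VI[of l] coeff_V[of l] b l in \<open>auto simp: less_Suc_eq_le\<close>)
qed

section \<open>The upper bound\<close>

text \<open>Since the monomials form a basis of \<open>T\<^sub>d\<close>, a functional on it is the
  pairing with its pullback. The condition defining \<open>veronese_span\<close> thus becomes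
  orthogonality to forms of degree \<open>d\<close> in the ideal.\<close>

lemma linear_eq_pairing_pullback:
  assumes "Vector_Spaces.linear pm_scale (*) \<phi>" "F \<in> pol_deg {0..n} d"
  shows "\<phi> F = pairing (veronese_pullback n d \<phi>) (lookup F)"
proof -
  interpret \<phi>: Vector_Spaces.linear pm_scale "(*)" \<phi> by fact
  have sub: "keys F \<subseteq> expos n d" using assms(2) by (auto simp: pol_deg_eq expos_def)
  have "\<phi> F = \<phi> (\<Sum>u\<in>keys F. pm_scale (lookup F u) (single u 1))"
    by (simp add: sum_single_keys flip: single_eq_pm_scale)
  also have "\<dots> = (\<Sum>u\<in>keys F. lookup F u * \<phi> (single u 1))"
    by (simp add: \<phi>.sum \<phi>.scale)
  also have "\<dots> = (\<Sum>u\<in>expos n d. lookup F u * \<phi> (single u 1))"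
    using sub by (intro sum.mono_neutral_left finite_expos) (auto simp: in_keys_iff)
  also have "\<dots> = pairing (veronese_pullback n d \<phi>) (lookup F)"
    by (simp add: veronese_pullback_def pairing_sum mult.commute)
  finally show ?thesis .
qed

lemma homogenization_subset_veronese_span:
  assumes W: "W \<subseteq> pol_deg_le {1..n} d\<^sub>1"
  shows "homogenization n d\<^sub>1 d\<^sub>2 W \<subseteq> veronese_span n (d\<^sub>1 + d\<^sub>2) (Ann_closure n W)"
  unfolding homogenization_eq_image[OF W]
proof clarify
  fix F assume F: "F \<in> W"
  hence F': "F \<in> pol_deg_le {1..n} d\<^sub>1" using W by auto
  have deg: "homogenize (d\<^sub>1 + d\<^sub>2) F \<in> pol_deg {0..n} (d\<^sub>1 + d\<^sub>2)"
    by (rule homogenize_in_pol_deg[OF F']) simp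
  have "\<phi> (homogenize (d\<^sub>1 + d\<^sub>2) F) = 0"
    if \<phi>: "Vector_Spaces.linear pm_scale (*) \<phi>" "veronese_pullback n (d\<^sub>1 + d\<^sub>2) \<phi> \<in> Ann_closure n W" for \<phi>
  proof -
    \<comment> \<open>The coefficients of the homogenized element are exactly the test function of
      \<open>Ann_closure\<close> with \<open>w = 0\<close> in degree
      \<open>d\<^sub>1 + d\<^sub>2\<close>.\<close>
    have "lookup (homogenize (d\<^sub>1 + d\<^sub>2) F) = (\<lambda>u. if mdeg u = d\<^sub>1 + d\<^sub>2 then lookup F (bar u + 0) else 0)"
      using lookup_homogenize[OF F', of "d\<^sub>1 + d\<^sub>2"] by (intro ext) simp
    thus ?thesis
      using \<phi>(2) F unfolding linear_eq_pairing_pullback[OF \<phi>(1) deg] Ann_closure_def by simp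
  qed
  thus "homogenize (d\<^sub>1 + d\<^sub>2) F \<in> veronese_span n (d\<^sub>1 + d\<^sub>2) (Ann_closure n W)"
    using deg by (simp add: veronese_span_def)
qed

text \<open>Monomials of degree at most \<open>d\<close> span \<open>S*/Ann(W)\<close>, so a basis
  can be selected among them. Monomials are needed because the columns of a catalecticant minor are
  indexed by them; the last clause serves to show that \<open>r\<close> is positive.\<close>

lemma monomial_basis_mod_Ann:
  fixes W :: "'k::field dpol set"
  assumes W: "W \<subseteq> pol_deg_le {1..n} d"
  obtains U where "finite U" "card U = quot_dim (pol_vars {1..n}) (Ann n W)"
    "\<And>u. u \<in> U \<Longrightarrow> keys u \<subseteq> {1..n} \<and> mdeg u \<le> d"
    "\<And>c. (\<Sum>u\<in>U. single u (c u)) \<in> Ann n W \<Longrightarrow> (\<forall>u\<in>U. c u = 0)"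
    "U = {} \<Longrightarrow> pol_vars {1..n} \<subseteq> Ann n W"
proof -
  obtain g :: "(nat, 'k) mpol \<Rightarrow> (nat, 'k) mpol" where g: "pm_linear g" "\<And>x. g x = 0 \<longleftrightarrow> x \<in> Ann n W"
    using pm_linear_with_kernel[OF subspace_Ann] by blast
  interpret g: Vector_Spaces.linear pm_scale pm_scale g by (rule g(1))
  define E where "E = {u :: nat expo. keys u \<subseteq> {1..n} \<and> mdeg u \<le> d}"
  let ?m = "\<lambda>u. g (single u 1)"
  obtain B where B: "B \<subseteq> ?m ` E" "pm.independent B" "?m ` E \<subseteq> pm.span B"
    using pm.maximal_independent_subset by blast
  obtain U where U: "U \<subseteq> E" "inj_on ?m U" "B = ?m ` U"
    using B(1) by (auto simp: subset_image_inj)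
  have "E \<subseteq> (\<Union>e\<le>d. expos n e)" by (force simp: E_def expos_def)
  hence "finite E" by (rule finite_subset) (auto simp: finite_expos)
  hence fin: "finite U" using U(1) finite_subset by blast
  have span: "g ` pol_vars {1..n} \<subseteq> pm.span B"
  proof clarify
    fix \<theta> :: "(nat, 'k) mpol" assume \<theta>: "\<theta> \<in> pol_vars {1..n}"
    obtain \<theta>' where \<theta>': "\<theta>' \<in> pol_deg_le {1..n} d" "\<theta> - \<theta>' \<in> Ann n W"
      using mod_Ann_low_degree[OF W \<theta>] by blast
    have "g \<theta> = g \<theta>'" using \<theta>'(2) g(2)[of "\<theta> - \<theta>'"] by (simp add: g.diff)
    also have "\<dots> = g (\<Sum>u\<in>keys \<theta>'. pm_scale (lookup \<theta>' u) (single u 1))"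
      by (simp add: sum_single_keys flip: single_eq_pm_scale)
    also have "\<dots> = (\<Sum>u\<in>keys \<theta>'. pm_scale (lookup \<theta>' u) (?m u))"
      by (simp add: g.sum g.scale)
    also have "\<dots> \<in> pm.span B"
    proof (intro pm.span_sum pm.span_scale)
      fix u assume "u \<in> keys \<theta>'"
      hence "u \<in> E" using pol_deg_leD[OF \<theta>'(1)] by (simp add: E_def)
      thus "?m u \<in> pm.span B" using B(3) by auto
    qed
    finally show "g \<theta> \<in> pm.span B" .
  qed
  have "quot_dim (pol_vars {1..n}) (Ann n W) = pm.dim (g ` pol_vars {1..n})"
    by (rule quot_dim_eq_dim_image[OF subspace_pol_vars subspace_Ann g(1)]) (rule g(2))
  also have "\<dots> = card B"
  proof (rule pm.basis_card_eq_dim[symmetric, OF _ span B(2)])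
    show "B \<subseteq> g ` pol_vars {1..n}"
      using U(1) unfolding U(3) E_def by (auto simp: pol_vars_def intro!: imageI)
  qed
  also have "\<dots> = card U" unfolding U(3) by (rule card_image[OF U(2)])
  finally have card: "card U = quot_dim (pol_vars {1..n}) (Ann n W)" ..
  have ind: "\<forall>u\<in>U. c u = 0" if "(\<Sum>u\<in>U. single u (c u)) \<in> Ann n W" for c
  proof
    fix u assume u: "u \<in> U"
    have "0 = g (\<Sum>u\<in>U. pm_scale (c u) (single u 1))"
      using that g(2) by (simp flip: single_eq_pm_scale)
    also have "\<dots> = (\<Sum>u\<in>U. pm_scale (c u) (?m u))" by (simp add: g.sum g.scale)
    also have "\<dots> = (\<Sum>x\<in>?m ` U. pm_scale (c (the_inv_into U ?m x)) x)"
      by (simp add: sum.reindex[OF U(2)] the_inv_into_f_f[OF U(2)] cong: sum.cong)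
    finally have "c (the_inv_into U ?m (?m u)) = 0"
      using u fin U(3) by (intro pm.independentD[OF B(2), where t = "?m ` U" and v = "?m u"]) auto
    thus "c u = 0" using u by (simp add: the_inv_into_f_f[OF U(2)])
  qed
  show ?thesis
  proof (rule that[OF fin card _ ind])
    show "keys u \<subseteq> {1..n} \<and> mdeg u \<le> d" if "u \<in> U" for u
      using that U(1) by (auto simp: E_def)
    show "pol_vars {1..n} \<subseteq> Ann n W" if "U = {}"
      using span g(2) U(3) that by auto
  qed
qed

text \<open>If the quotient were zero, the constant 1 would annihilate \<open>W\<close>, which
  forces every element of \<open>W\<close> to vanish.\<close>

lemma quot_dim_Ann_pos:
  assumes "W \<subseteq> pol_deg_le {1..n} d" "pm.subspace W" "W \<noteq> {0}"
  shows "quot_dim (pol_vars {1..n}) (Ann n W) > 0"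
proof -
  obtain U :: "nat expo set" where U: "finite U" "card U = quot_dim (pol_vars {1..n}) (Ann n W)"
    "U = {} \<Longrightarrow> pol_vars {1..n} \<subseteq> Ann n W"
    using monomial_basis_mod_Ann[OF assms(1)] by metis
  have "U \<noteq> {}"
  proof
    assume "U = {}"
    moreover have "(1 :: (nat, 'a) mpol) \<in> pol_vars {1..n}" by (simp add: pol_vars_def)
    ultimately have "(1 :: (nat, 'a) mpol) \<in> Ann n W" using U(3) by blast
    hence "lookup F w = 0" if "F \<in> W" for F w
      using that by (auto simp: Ann_iff simp flip: single_one)
    hence "W \<subseteq> {0}" by (auto intro!: poly_mapping_eqI)
    with assms(2,3) show False using pm.subspace_0[OF assms(2)] by auto
  qed
  thus ?thesis using U(1) card_gt_0_iff[of U] unfolding U(2) by blast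
qed

lemma zero_dim_subscheme_Ann_closure:
  assumes "W \<subseteq> pol_deg_le {1..n} d" "pm.subspace W" "W \<noteq> {0}"
  shows "zero_dim_subscheme n (quot_dim (pol_vars {1..n}) (Ann n W)) (Ann_closure n W)"
  unfolding zero_dim_subscheme_def
  using hom_ideal_Ann_closure saturated_Ann_closure quot_dim_Ann_pos[OF assms]
    quot_dim_Ann_closure[OF assms(1)] by blast

lemma cactus_rank_homogenization_le:
  assumes "W \<subseteq> pol_deg_le {1..n} d\<^sub>1" "pm.subspace W" "W \<noteq> {0}"
  shows "cactus_rank n (d\<^sub>1 + d\<^sub>2) (homogenization n d\<^sub>1 d\<^sub>2 W)
    \<le> enat (quot_dim (pol_vars {1..n}) (Ann n W))"
  unfolding cactus_rank_def
  using zero_dim_subscheme_Ann_closure[OF assms] homogenization_subset_veronese_span[OF assms(1)]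
    quot_dim_Ann_pos[OF assms]
  by (intro Inf_lower) blast

section \<open>Minors of the catalecticant in Pluecker coordinates\<close>

text \<open>A family of rows with no nonzero common orthogonal vector contains \<open>m\<close>
  independent ones. By induction: the cofactors along a still undetermined last row form a vector
  whose last entry is the minor already found, hence nonzero; some row of \<open>R\<close> is not
  orthogonal to it.\<close>

lemma exists_nonzero_minor:
  fixes R :: "(nat \<Rightarrow> 'k::field) set"
  assumes "\<And>c. \<exists>b<m. c b \<noteq> 0 \<Longrightarrow> \<exists>\<rho>\<in>R. (\<Sum>b<m. \<rho> b * c b) \<noteq> 0"
  obtains \<rho> where "\<And>a. a < m \<Longrightarrow> \<rho> a \<in> R" "det (mat m m (\<lambda>(a, b). \<rho> a b)) \<noteq> 0"
proof -
  have "\<exists>\<rho>. (\<forall>a<m. \<rho> a \<in> R) \<and> det (mat m m (\<lambda>(a, b). \<rho> a b)) \<noteq> 0"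
    using assms
  proof (induction m)
    case 0
    show ?case by (auto simp: det_def)
  next
    case (Suc m)
    have "\<exists>\<rho>\<in>R. (\<Sum>b<m. \<rho> b * c b) \<noteq> 0" if "\<exists>b<m. c b \<noteq> 0" for c
    proof -
      \<comment> \<open>A vector of length \<open>m\<close> is extended by a zero entry so that the
        hypothesis for \<open>Suc m\<close> applies.\<close>
      have "\<exists>b<Suc m. (c(m := 0)) b \<noteq> 0" using that by (auto intro: less_SucI)
      from Suc.prems[OF this] show ?thesis by simp
    qed
    from Suc.IH[OF this] obtain \<rho> where
      \<rho>: "\<And>a. a < m \<Longrightarrow> \<rho> a \<in> R" "det (mat m m (\<lambda>(a, b). \<rho> a b)) \<noteq> 0" by auto
    \<comment> \<open>Only the last row depends on \<open>\<sigma>\<close>; the cofactors along it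
      do not, so \<open>undefined\<close> below is a mere placeholder.\<close>
    define M where "M \<sigma> = mat (Suc m) (Suc m) (\<lambda>(a, b). (\<rho>(m := \<sigma>)) a b)" for \<sigma>
    define c where "c b = cofactor (M undefined) m b" for b
    have del: "mat_delete (M \<sigma>) m b = mat_delete (M undefined) m b" if "b < Suc m" for \<sigma> b
      using that by (intro eq_matI) (auto simp: mat_delete_def M_def)
    have det: "det (M \<sigma>) = (\<Sum>b<Suc m. \<sigma> b * c b)" for \<sigma>
    proof -
      have "det (M \<sigma>) = (\<Sum>b<Suc m. M \<sigma> $$ (m, b) * cofactor (M \<sigma>) m b)"
        by (rule laplace_expansion_row) (simp_all add: M_def)
      also have "\<dots> = (\<Sum>b<Suc m. \<sigma> b * c b)"
      proof (rule sum.cong[OF refl])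
        fix b assume "b \<in> {..<Suc m}"
        hence b: "b < Suc m" by simp
        have "M \<sigma> $$ (m, b) = \<sigma> b" using b by (simp add: M_def)
        thus "M \<sigma> $$ (m, b) * cofactor (M \<sigma>) m b = \<sigma> b * c b"
          by (simp only: c_def cofactor_def del[OF b, of \<sigma>])
      qed
      finally show ?thesis .
    qed
    have "mat_delete (M undefined) m m = mat m m (\<lambda>(a, b). \<rho> a b)"
      by (intro eq_matI) (auto simp: mat_delete_def M_def)
    hence "c m \<noteq> 0" using \<rho>(2) by (simp add: c_def cofactor_def)
    then obtain \<sigma> where \<sigma>: "\<sigma> \<in> R" "det (M \<sigma>) \<noteq> 0"
      unfolding det using Suc.prems[of c] by blast
    show ?case
      by (rule exI[of _ "\<rho>(m := \<sigma>)"]) (use \<sigma> \<rho>(1) in \<open>auto simp: M_def less_Suc_eq\<close>)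
  qed
  thus ?thesis using that by blast
qed

text \<open>The Leibniz formula as a form in variables indexed by \<open>'v\<close>. The variables
  \<open>x a b\<close> may coincide, hence the exponent is a sum of \<open>single\<close>s, which
  counts repetitions.\<close>

definition det_form :: "nat \<Rightarrow> (nat \<Rightarrow> nat \<Rightarrow> 'v) \<Rightarrow> ('v, 'k::field) mpol" where
  "det_form m x = (\<Sum>p | p permutes {0..<m}. single (\<Sum>a = 0..<m. single (x a (p a)) 1) (signof p))"

lemma monomial_eval_superset:
  fixes z :: "'v \<Rightarrow> 'k::field"
  assumes "finite A" "keys u \<subseteq> A"
  shows "(\<Prod>i\<in>keys u. z i ^ lookup u i) = (\<Prod>i\<in>A. z i ^ lookup u i)"
  using assms by (intro prod.mono_neutral_left) (auto simp: in_keys_iff)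

lemma monomial_eval_add:
  fixes z :: "'v \<Rightarrow> 'k::field"
  shows "(\<Prod>i\<in>keys (u + v). z i ^ lookup (u + v) i)
    = (\<Prod>i\<in>keys u. z i ^ lookup u i) * (\<Prod>i\<in>keys v. z i ^ lookup v i)"
proof -
  let ?A = "keys u \<union> keys v"
  have "(\<Prod>i\<in>keys (u + v). z i ^ lookup (u + v) i) = (\<Prod>i\<in>?A. z i ^ lookup u i * z i ^ lookup v i)"
    by (simp add: keys_add_expo lookup_add power_add)
  thus ?thesis
    by (simp add: prod.distrib monomial_eval_superset[of ?A])
qed

lemma monomial_eval_sum:
  fixes z :: "'v \<Rightarrow> 'k::field" and x :: "nat \<Rightarrow> 'v"
  assumes "u = (\<Sum>a\<in>X. single (x a) (1::nat))"
  shows "(\<Prod>i\<in>keys u. z i ^ lookup u i) = (\<Prod>a\<in>X. z (x a))"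
  unfolding assms
  by (induction X rule: infinite_finite_induct) (simp_all add: monomial_eval_add)

lemma mpol_eval_det_form:
  "mpol_eval z (det_form m x) = det (mat m m (\<lambda>(a, b). z (x a b)))"
proof -
  have "mpol_eval z (det_form m x) = (\<Sum>p | p permutes {0..<m}. signof p * (\<Prod>a = 0..<m. z (x a (p a))))"
    unfolding mpol_eval_eq_pairing det_form_def pairing_sum pairing_single
    by (intro sum.cong refl arg_cong2[of _ _ _ _ "(*)"] monomial_eval_sum)
  also have "\<dots> = det (mat m m (\<lambda>(a, b). z (x a b)))"
    by (subst det_def'[of _ m])
       (auto intro!: sum.cong prod.cong arg_cong2[of _ _ _ _ "(*)"] simp: permutes_in_image)
  finally show ?thesis .
qed

lemma det_form_in_pol_deg:
  fixes x :: "nat \<Rightarrow> nat \<Rightarrow> 'v"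
  assumes "\<And>a b. a < m \<Longrightarrow> b < m \<Longrightarrow> x a b \<in> X"
  shows "(det_form m x :: ('v, 'k::field) mpol) \<in> pol_deg X m"
  unfolding det_form_def
proof (rule pm.subspace_sum[OF subspace_pol_deg])
  fix p assume "p \<in> {p. p permutes {0..<m}}"
  hence "p permutes {0..<m}" by simp
  hence p: "p a < m" if "a < m" for a
    using that permutes_in_image[of p "{0..<m}" a] by simp
  let ?u = "\<Sum>a = 0..<m. single (x a (p a)) (1::nat)"
  have "keys ?u \<subseteq> (\<Union>a\<in>{0..<m}. keys (single (x a (p a)) (1::nat)))"
    by (rule keys_sum)
  also have "\<dots> \<subseteq> X" using assms p by auto
  finally have "keys ?u \<subseteq> X" .
  moreover have "mdeg ?u = m" by (simp add: mdeg_sum)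
  ultimately show "single ?u (signof p) \<in> pol_deg X m" by (auto simp: pol_deg_eq)
qed

text \<open>Laplace expansion along column \<open>j\<close>, the only one that depends on
  \<open>w\<close>. The cofactors are fixed, so as a function of \<open>w\<close> the coordinate is
  a linear combination of the coefficients of the basis elements.\<close>

lemma plucker_list_update:
  assumes us: "length us = length bs" and j: "j < length bs"
  shows "plucker bs (us[j := w]) = (\<Sum>i<length bs. lookup (bs ! i) w *
    cofactor (mat (length bs) (length bs) (\<lambda>(i, l). lookup (bs ! i) (us ! l))) i j)"
proof -
  let ?k = "length bs"
  define M where "M = mat ?k ?k (\<lambda>(i, l). lookup (bs ! i) (us ! l))"
  define M' where "M' = mat ?k ?k (\<lambda>(i, l). lookup (bs ! i) (us[j := w] ! l))"
  have del: "mat_delete M' i j = mat_delete M i j" if "i < ?k" for i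
    using that us j by (intro eq_matI) (auto simp: mat_delete_def M_def M'_def nth_list_update)
  have "plucker bs (us[j := w]) = (\<Sum>i<?k. M' $$ (i, j) * cofactor M' i j)"
    unfolding plucker_def M'_def[symmetric]
    by (rule laplace_expansion_column) (use j in \<open>auto simp: M'_def\<close>)
  also have "\<dots> = (\<Sum>i<?k. lookup (bs ! i) w * cofactor M i j)"
  proof (rule sum.cong[OF refl])
    fix i assume "i \<in> {..<?k}"
    hence i: "i < ?k" by simp
    have "M' $$ (i, j) = lookup (bs ! i) w" using i j us by (simp add: M'_def)
    thus "M' $$ (i, j) * cofactor M' i j = lookup (bs ! i) w * cofactor M i j"
      by (simp only: cofactor_def del[OF i])
  qed
  finally show ?thesis unfolding M_def .
qed

text \<open>
  Replacing one entry of a tuple of monomials by a variable monomial turns the Pluecker coordinates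
  into the coefficients of an element of the subspace. The catalecticant of the subspace can thus be
  written in Pluecker coordinates, with the same rank.
\<close>

lemma plucker_list_update_in_subspace:
  assumes V: "pm.subspace V" "set bs \<subseteq> V" and us: "length us = length bs" "j < length bs"
  shows "\<exists>G\<in>V. \<forall>u. plucker bs (us[j := u]) = lookup G u"
proof -
  let ?M = "mat (length bs) (length bs) (\<lambda>(i, l). lookup (bs ! i) (us ! l))"
  define G where "G = (\<Sum>i<length bs. pm_scale (cofactor ?M i j) (bs ! i))"
  have "plucker bs (us[j := u]) = lookup G u" for u
    unfolding plucker_list_update[OF us] by (simp add: G_def lookup_sum mult.commute)
  moreover have "G \<in> V"
    unfolding G_def using V(2)
    by (intro pm.subspace_sum[OF V(1)] pm.subspace_scale[OF V(1)]) auto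
  ultimately show ?thesis by blast
qed

text \<open>If a functional does not vanish on the subspace, it does not vanish on one of the
  elements produced by varying an entry of a suitable tuple. Choose a tuple with nonzero Pluecker
  coordinate, so that its matrix \<open>M\<close> is invertible, and let \<open>x\<close> be the
  nonzero vector of values of the functional on the basis. By Cramer's rule, replacing column
  \<open>j\<close> of \<open>M\<close> by \<open>x\<close> gives a determinant proportional to the
  \<open>j\<close>-th entry of the solution of \<open>M z = x\<close>, and some entry of that
  solution is nonzero.\<close>

lemma plucker_detects_functional:
  fixes bs :: "'k::field dpol list"
  assumes ind: "distinct bs" "pm.independent (set bs)" and deg: "set bs \<subseteq> pol_deg {0..n} d"
    and G: "G \<in> pm.span (set bs)" and nz: "(\<Sum>b\<in>X. c b * lookup G (y b)) \<noteq> 0"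
  obtains us j where "length us = length bs" "set us \<subseteq> expos n d" "j < length bs"
    "(\<Sum>b\<in>X. c b * plucker bs (us[j := y b])) \<noteq> 0"
proof -
  let ?k = "length bs"
  define R where "R = (\<lambda>u i. lookup (bs ! i) u) ` expos n d"
  have set_bs: "set bs = (!) bs ` {..<?k}" by (auto simp: set_conv_nth)
  have inj: "inj_on ((!) bs) {..<?k}" using ind(1) by (auto simp: inj_on_def nth_eq_iff_index_eq)
  have "\<exists>\<rho>\<in>R. (\<Sum>i<?k. \<rho> i * x i) \<noteq> 0" if x: "\<exists>i<?k. x i \<noteq> 0" for x
  proof (rule ccontr)
    assume "\<not> ?thesis"
    hence z: "(\<Sum>i<?k. lookup (bs ! i) u * x i) = 0" if "u \<in> expos n d" for u
      using that by (auto simp: R_def)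
    have "(\<Sum>i<?k. pm_scale (x i) (bs ! i)) = 0"
    proof (rule poly_mapping_eqI)
      fix u
      show "lookup (\<Sum>i<?k. pm_scale (x i) (bs ! i)) u = lookup 0 u"
      proof (cases "u \<in> expos n d")
        case True
        thus ?thesis using z by (simp add: lookup_sum mult.commute)
      next
        case False
        have "lookup (bs ! i) u = 0" if "i < ?k" for i
          proof -
          have "bs ! i \<in> pol_deg {0..n} d" using deg nth_mem[OF that] by (rule subsetD)
          thus ?thesis using False by (auto simp: pol_deg_eq expos_def in_keys_iff)
        qed
        thus ?thesis by (simp add: lookup_sum)
      qed
    qed
    hence "(\<Sum>v\<in>set bs. pm_scale (x (the_inv_into {..<?k} ((!) bs) v)) v) = 0"
      unfolding set_bs sum.reindex[OF inj]
      by (simp add: the_inv_into_f_f[OF inj] cong: sum.cong_simp)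
    hence "x (the_inv_into {..<?k} ((!) bs) (bs ! i)) = 0" if "i < ?k" for i
      using that by (intro pm.independentD[OF ind(2), where t = "set bs" and v = "bs ! i"]) auto
    thus False using x by (auto simp: the_inv_into_f_f[OF inj])
  qed
  \<comment> \<open>The rows of this minor are monomials of degree \<open>d\<close>: they form a
    tuple at which the Pluecker coordinate of the subspace does not vanish.\<close>
  from exists_nonzero_minor[OF this] obtain \<rho> where
    \<rho>: "\<And>a. a < ?k \<Longrightarrow> \<rho> a \<in> R" "det (mat ?k ?k (\<lambda>(a, b). \<rho> a b)) \<noteq> 0" by blast
  have "\<forall>a. \<exists>w. a < ?k \<longrightarrow> w \<in> expos n d \<and> \<rho> a = (\<lambda>i. lookup (bs ! i) w)"
    using \<rho>(1) by (fastforce simp: R_def)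
  from choice[OF this] obtain u where u: "\<And>a. a < ?k \<Longrightarrow> u a \<in> expos n d" "\<And>a. a < ?k \<Longrightarrow> \<rho> a = (\<lambda>i. lookup (bs ! i) (u a))"
    by blast
  define us where "us = map u [0..<?k]"
  have us: "length us = ?k" "set us \<subseteq> expos n d" "\<And>a. a < ?k \<Longrightarrow> us ! a = u a"
    using u(1) by (auto simp: us_def)
  define M where "M = mat ?k ?k (\<lambda>(i, l). lookup (bs ! i) (us ! l))"
  have M: "M \<in> carrier_mat ?k ?k" by (simp add: M_def)
  have "M = transpose_mat (mat ?k ?k (\<lambda>(a, b). \<rho> a b))"
    by (intro eq_matI) (auto simp: M_def u(2) us(3))
  hence "det M \<noteq> 0" using \<rho>(2) by (simp add: det_transpose[of _ ?k])
  define x where "x = vec ?k (\<lambda>i. \<Sum>b\<in>X. c b * lookup (bs ! i) (y b))"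
  have x: "x \<in> carrier_vec ?k" by (simp add: x_def)
  obtain N where N: "N \<in> carrier_mat ?k ?k" "M * N = 1\<^sub>m ?k"
    using det_non_zero_imp_unit[OF M \<open>det M \<noteq> 0\<close>, of "()"]
    by (auto simp: Units_def ring_mat_def)
  define z where "z = N *\<^sub>v x"
  have z: "z \<in> carrier_vec ?k" "M *\<^sub>v z = x"
    using N x M by (auto simp: z_def assoc_mult_mat_vec[symmetric, OF M N(1) x])
  \<comment> \<open>A functional vanishing on the basis would vanish on its span, in particular on
    \<open>G\<close>.\<close>
  have "x \<noteq> 0\<^sub>v ?k"
  proof
    assume "x = 0\<^sub>v ?k"
    hence x0: "(\<Sum>b\<in>X. c b * lookup v (y b)) = 0" if "v \<in> set bs" for v
      using that unfolding x_def set_bs by (auto simp: vec_eq_iff)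
    have "(\<Sum>b\<in>X. c b * lookup G (y b)) = 0"
      using G
    proof (induction rule: pm.span_induct_alt)
      case base
      show ?case by simp
    next
      case (step e v G)
      have "(\<Sum>b\<in>X. c b * lookup (pm_scale e v + G) (y b))
        = e * (\<Sum>b\<in>X. c b * lookup v (y b)) + (\<Sum>b\<in>X. c b * lookup G (y b))"
        by (simp add: lookup_add sum.distrib sum_distrib_left algebra_simps)
      thus ?case using step x0 by simp
    qed
    with nz show False by simp
  qed
  have "z \<noteq> 0\<^sub>v ?k"
  proof
    assume "z = 0\<^sub>v ?k"
    hence "x = 0\<^sub>v ?k" using z(2) M by (auto intro!: eq_vecI)
    with \<open>x \<noteq> 0\<^sub>v ?k\<close> show False by simp
  qed
  then obtain j where j: "j < ?k" "z $ j \<noteq> 0"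
    using z(1) by (metis carrier_vecD eq_vecI index_zero_vec(1) index_zero_vec(2))
  have "det (replace_col M x j) \<noteq> 0"
    using cramer_lemma_mat[OF M z(1) j(1)] z(2) j(2) \<open>det M \<noteq> 0\<close> by simp
  moreover have "det (replace_col M x j) = (\<Sum>b\<in>X. c b * plucker bs (us[j := y b]))"
  proof -
    have pl: "plucker bs (us[j := w]) = (\<Sum>i<?k. lookup (bs ! i) w * cofactor M i j)" for w
      unfolding M_def by (rule plucker_list_update[OF us(1) j(1)])
    have M'': "replace_col M x j \<in> carrier_mat ?k ?k" by (simp add: replace_col_def M_def)
    have del: "mat_delete (replace_col M x j) i j = mat_delete M i j" if "i < ?k" for i
      using that j by (intro eq_matI) (auto simp: mat_delete_def M_def replace_col_def)
    have "det (replace_col M x j) = (\<Sum>i<?k. x $ i * cofactor M i j)"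
      unfolding laplace_expansion_column[OF M'' j(1)]
    proof (rule sum.cong[OF refl])
      fix i assume "i \<in> {..<?k}"
      hence i: "i < ?k" by simp
      have "replace_col M x j $$ (i, j) = x $ i" using i j by (simp add: replace_col_def M_def)
      thus "replace_col M x j $$ (i, j) * cofactor (replace_col M x j) i j = x $ i * cofactor M i j"
        by (simp only: cofactor_def del[OF i])
    qed
    also have "\<dots> = (\<Sum>i<?k. \<Sum>b\<in>X. c b * lookup (bs ! i) (y b) * cofactor M i j)"
      by (simp add: x_def sum_distrib_right)
    also have "\<dots> = (\<Sum>b\<in>X. c b * plucker bs (us[j := y b]))"
      by (subst sum.swap) (simp add: pl sum_distrib_left mult.assoc)
    finally show ?thesis .
  qed
  ultimately show ?thesis using that[OF us(1,2) j(1)] by simp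
qed

text \<open>Columns are the monomials \<open>u b\<close> of degree \<open>d\<^sub>1\<close>. Row
  \<open>a\<close> belongs to the monomial \<open>w a\<close> of degree \<open>d\<^sub>2\<close> and
  to the element of the subspace encoded by the tuple \<open>us a\<close> with variable position
  \<open>j a\<close>; its entries stand for the coefficients of that element at
  \<open>u b + w a\<close>. Repetitions among rows or columns are allowed, as they only add minors
  whose values are zero.\<close>

definition catalecticant_minors ::
    "nat \<Rightarrow> nat \<Rightarrow> nat \<Rightarrow> nat \<Rightarrow> nat \<Rightarrow> (nat expo list, 'k::field) mpol set" where
  "catalecticant_minors n d\<^sub>1 d\<^sub>2 k m = {det_form m (\<lambda>a b. (us a)[j a := u b + w a]) | us j u w.
     \<forall>a<m. length (us a) = k \<and> set (us a) \<subseteq> expos n (d\<^sub>1 + d\<^sub>2) \<and> j a < k \<and>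
       u a \<in> expos n d\<^sub>1 \<and> w a \<in> expos n d\<^sub>2}"

lemma expos_add: "u \<in> expos n d \<Longrightarrow> w \<in> expos n e \<Longrightarrow> u + w \<in> expos n (d + e)"
  by (auto simp: expos_def keys_add_expo mdeg_add)

lemma catalecticant_minors_subset:
  "catalecticant_minors n d\<^sub>1 d\<^sub>2 k m \<subseteq> (plucker_forms n (d\<^sub>1 + d\<^sub>2) k :: (nat expo list, 'k::field) mpol set)"
proof
  fix P :: "(nat expo list, 'k) mpol" assume "P \<in> catalecticant_minors n d\<^sub>1 d\<^sub>2 k m"
  then obtain us j u w where P: "P = det_form m (\<lambda>a b. (us a)[j a := u b + w a])"
    and *: "\<forall>a<m. length (us a) = k \<and> set (us a) \<subseteq> expos n (d\<^sub>1 + d\<^sub>2) \<and> j a < k \<and>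
       u a \<in> expos n d\<^sub>1 \<and> w a \<in> expos n d\<^sub>2"
    unfolding catalecticant_minors_def by blast
  have "P \<in> pol_deg {us. length us = k \<and> set us \<subseteq> expos n (d\<^sub>1 + d\<^sub>2)} m"
    unfolding P
  proof (rule det_form_in_pol_deg)
    fix a b assume ab: "a < m" "b < m"
    have "u b + w a \<in> expos n (d\<^sub>1 + d\<^sub>2)" using * ab by (auto intro: expos_add)
    thus "(us a)[j a := u b + w a] \<in> {us. length us = k \<and> set us \<subseteq> expos n (d\<^sub>1 + d\<^sub>2)}"
      using * ab(1) set_update_subset_insert[of "us a" "j a" "u b + w a"] by auto
  qed
  thus "P \<in> plucker_forms n (d\<^sub>1 + d\<^sub>2) k" unfolding plucker_forms_def by blast
qed

section \<open>Vanishing of the minors on subspaces of small cactus rank\<close>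

text \<open>Every form of degree \<open>d\<close> is the pullback of a functional, namely of the
  pairing with that form; hence the span is orthogonal to all forms of degree \<open>d\<close> in
  \<open>I\<close>.\<close>

lemma veronese_span_pairing:
  fixes G :: "'k::field dpol"
  assumes G: "G \<in> veronese_span n d I" and f: "f \<in> I" "f \<in> pol_deg {0..n} d"
  shows "pairing f (lookup G) = 0"
proof -
  define \<phi> where "\<phi> H = (\<Sum>u\<in>keys f. lookup f u * lookup H u)" for H :: "'k dpol"
  have "Vector_Spaces.linear pm_scale (*) \<phi>"
    by unfold_locales
       (auto simp: \<phi>_def lookup_add sum.distrib sum_distrib_left algebra_simps)
  moreover have "veronese_pullback n d \<phi> = f"
  proof (rule poly_mapping_eqI)
    fix u
    have "\<phi> (single u 1) = lookup f u" for u
    proof -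
      have "\<phi> (single u 1) = (\<Sum>v\<in>keys f. if v = u then lookup f v else 0)"
        unfolding \<phi>_def by (rule sum.cong) (auto simp: lookup_single when_def)
      thus ?thesis by (simp add: in_keys_iff)
    qed
    hence "lookup (veronese_pullback n d \<phi>) u = (\<Sum>v\<in>expos n d. if v = u then lookup f v else 0)"
      by (simp add: veronese_pullback_def lookup_sum lookup_single when_def)
    also have "\<dots> = (if u \<in> expos n d then lookup f u else 0)"
      by (simp add: finite_expos)
    also have "\<dots> = lookup f u"
      using f(2) by (auto simp: pol_deg_eq expos_def in_keys_iff)
    finally show "lookup (veronese_pullback n d \<phi>) u = lookup f u" .
  qed
  ultimately have "\<phi> G = 0" using G f(1) by (auto simp: veronese_span_def)
  thus ?thesis by (simp add: \<phi>_def pairing_def)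
qed

lemma cactus_rank_leE:
  assumes "cactus_rank n d V \<le> enat s"
  obtains r I where "0 < r" "r \<le> s" "zero_dim_subscheme n r I" "V \<subseteq> veronese_span n d I"
proof -
  let ?A = "{enat r | r. r > 0 \<and> (\<exists>I. zero_dim_subscheme n r I \<and> V \<subseteq> veronese_span n d I)}"
  have le: "Inf ?A \<le> enat s" using assms unfolding cactus_rank_def .
  \<comment> \<open>The infimum of the empty set is infinite, hence not at most \<open>s\<close>; a
    nonempty set of \<open>enat\<close> attains its infimum.\<close>
  have "?A \<noteq> {}"
  proof
    assume "?A = {}"
    hence "Inf ?A = Inf {}" by (rule arg_cong)
    with le show False by (simp add: top_enat_def)
  qed
  then obtain x where "x \<in> ?A" by blast
  hence "Inf ?A \<in> ?A" by (rule wellorder_InfI)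
  then obtain r I where "Inf ?A = enat r" "0 < r" "zero_dim_subscheme n r I" "V \<subseteq> veronese_span n d I"
    by blast
  thus ?thesis using le that by simp
qed

text \<open>The \<open>s + 1\<close> monomials \<open>u b\<close> satisfy a nontrivial relation
  \<theta> modulo the ideal of the scheme. Its coefficients do not depend on the row: multiplying
  \<theta> by \<open>w a\<close> stays in the ideal, and every element of \<open>V\<close> is
  orthogonal to the result. The coefficient vector is therefore in the kernel of the whole
  matrix.\<close>

lemma catalecticant_minors_vanish:
  fixes V :: "'k::field dpol set"
  assumes V: "V \<in> Gr n (d\<^sub>1 + d\<^sub>2) k" and rank: "cactus_rank n (d\<^sub>1 + d\<^sub>2) V \<le> enat s"
    and P: "P \<in> catalecticant_minors n d\<^sub>1 d\<^sub>2 k (Suc s)" and bs: "basis_list V bs"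
  shows "mpol_eval (plucker bs) P = 0"
proof -
  obtain us j u w where P_eq: "P = det_form (Suc s) (\<lambda>a b. (us a)[j a := u b + w a])"
    and *: "\<forall>a<Suc s. length (us a) = k \<and> set (us a) \<subseteq> expos n (d\<^sub>1 + d\<^sub>2) \<and> j a < k \<and>
       u a \<in> expos n d\<^sub>1 \<and> w a \<in> expos n d\<^sub>2"
    using P unfolding catalecticant_minors_def by blast
  obtain r I where I: "r \<le> s" "zero_dim_subscheme n r I" "V \<subseteq> veronese_span n (d\<^sub>1 + d\<^sub>2) I"
    using cactus_rank_leE[OF rank] by metis
  have hI: "hom_ideal n I" using I(2) by (simp add: zero_dim_subscheme_def)
  have len: "length bs = k"
    using bs V pm.dim_span_eq_card_independent[of "set bs"]
    by (auto simp: basis_list_def Gr_def distinct_card)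
  have f: "single (u b) 1 \<in> (pol_deg {0..n} d\<^sub>1 :: (nat, 'k) mpol set)" if "b \<le> s" for b
    using * that by (auto simp: pol_deg_eq expos_def)
  obtain c :: "nat \<Rightarrow> 'k" where
    c: "(\<Sum>b\<le>s. pm_scale (c b) (single (u b) 1)) \<in> I" "\<exists>b\<le>s. c b \<noteq> 0"
    using forms_dependent_mod_zero_dim[OF I(2,1), of "\<lambda>b. single (u b) 1" d\<^sub>1] f by blast
  define \<theta> where "\<theta> = (\<Sum>b\<le>s. pm_scale (c b) (single (u b) 1))"
  have \<theta>: "\<theta> \<in> I" "\<theta> \<in> pol_deg {0..n} d\<^sub>1"
    unfolding \<theta>_def
    using c(1) by (auto intro!: pm.subspace_sum[OF subspace_pol_deg] pm.subspace_scale[OF subspace_pol_deg] f)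
  define M where "M = mat (Suc s) (Suc s) (\<lambda>(a, b). plucker bs ((us a)[j a := u b + w a]))"
  have row: "(\<Sum>b\<le>s. plucker bs ((us a)[j a := u b + w a]) * c b) = 0" if a: "a < Suc s" for a
  proof -
    have sub: "pm.subspace V" "set bs \<subseteq> V"
      using V bs pm.span_superset[of "set bs"] by (auto simp: Gr_def basis_list_def)
    have us: "length (us a) = length bs" "j a < length bs" using * a len by auto
    obtain G where G: "G \<in> V" "\<forall>u. plucker bs ((us a)[j a := u]) = lookup G u"
      using plucker_list_update_in_subspace[OF sub us] by blast
    have w: "single (w a) (1::'k) \<in> pol_deg {0..n} d\<^sub>2" using * a by (auto simp: pol_deg_eq expos_def)
    have "single (w a) 1 * \<theta> \<in> I"
      using w by (intro hom_idealD(3)[OF hI \<theta>(1)]) (simp add: pol_deg_def)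
    moreover have "single (w a) 1 * \<theta> \<in> pol_deg {0..n} (d\<^sub>1 + d\<^sub>2)"
      using pol_deg_mult[OF w \<theta>(2)] by (simp add: add.commute)
    ultimately have "pairing (single (w a) 1 * \<theta>) (lookup G) = 0"
      using G(1) I(3) by (intro veronese_span_pairing[of G n "d\<^sub>1 + d\<^sub>2" I]) auto
    hence "(\<Sum>b\<le>s. c b * lookup G (w a + u b)) = 0"
      by (simp add: pairing_single_mult \<theta>_def pairing_sum pairing_pm_scale)
    thus ?thesis using G(2) by (simp add: mult.commute add.commute)
  qed
  have M: "M \<in> carrier_mat (Suc s) (Suc s)" by (simp add: M_def)
  have "M *\<^sub>v vec (Suc s) c = 0\<^sub>v (Suc s)"
  proof (rule eq_vecI)
    fix a assume "a < dim_vec (0\<^sub>v (Suc s) :: 'k vec)"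
    hence a: "a < Suc s" by simp
    have "(M *\<^sub>v vec (Suc s) c) $ a = (\<Sum>b\<le>s. plucker bs ((us a)[j a := u b + w a]) * c b)"
      using a by (auto simp: M_def scalar_prod_def atLeast0LessThan lessThan_Suc_atMost intro!: sum.cong)
    thus "(M *\<^sub>v vec (Suc s) c) $ a = 0\<^sub>v (Suc s) $ a" using row[OF a] a by simp
  qed (simp add: M_def)
  moreover have "vec (Suc s) c \<noteq> 0\<^sub>v (Suc s)"
  proof
    assume "vec (Suc s) c = 0\<^sub>v (Suc s)"
    hence "c b = 0" if "b < Suc s" for b using that by (metis index_vec index_zero_vec(1))
    thus False using c(2) by auto
  qed
  ultimately have "det M = 0"
    using det_0_iff_vec_prod_zero[OF M] by (metis vec_carrier)
  thus ?thesis unfolding P_eq mpol_eval_det_form M_def by simp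
qed

section \<open>A nonvanishing minor for the homogenization\<close>

lemma basis_list_exists:
  assumes "pm.subspace V" "V \<subseteq> pol_deg {0..n} d"
  obtains bs where "basis_list V bs" "length bs = pm.dim V"
proof -
  obtain B where B: "B \<subseteq> V" "pm.independent B" "V \<subseteq> pm.span B" "card B = pm.dim V"
    by (rule pm.basis_exists)
  have "B \<subseteq> pm.span ((\<lambda>u. single u 1) ` expos n d)"
    using B(1) assms(2) pol_deg_eq_span by blast
  hence "finite B"
    by (rule pm.independent_span_bound[OF _ B(2), THEN conjunct1, rotated])
       (intro finite_imageI finite_expos)
  then obtain bs where bs: "set bs = B" "distinct bs" using finite_distinct_list by blast
  have "pm.span B = V" using B(1,3) pm.span_minimal[OF B(1) assms(1)] by auto
  thus ?thesis using that[of bs] bs B(2,4) distinct_card[of bs] by (simp add: basis_list_def)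
qed

lemma homogenization_in_Gr:
  assumes "pm.subspace W" "W \<subseteq> pol_deg_le {1..n} d\<^sub>1"
  shows "homogenization n d\<^sub>1 d\<^sub>2 W \<in> Gr n (d\<^sub>1 + d\<^sub>2) (pm.dim (homogenization n d\<^sub>1 d\<^sub>2 W))"
proof -
  interpret h: Vector_Spaces.linear pm_scale pm_scale "homogenize (d\<^sub>1 + d\<^sub>2) :: 'a dpol \<Rightarrow> _"
    by (rule pm_linear_homogenize)
  have "homogenize (d\<^sub>1 + d\<^sub>2) ` W \<subseteq> pol_deg {0..n} (d\<^sub>1 + d\<^sub>2)"
    using assms(2) by (auto intro!: homogenize_in_pol_deg[of _ n d\<^sub>1])
  thus ?thesis
    using h.subspace_image[OF assms(1)] unfolding homogenization_eq_image[OF assms(2)] Gr_def by simp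
qed

text \<open>
  The hypothesis \<open>d\<^sub>1 \<le> d\<^sub>2\<close> leaves room to homogenize the contracting monomials \<open>w\<close>, which have degree at
  most \<open>d\<^sub>1\<close>, to degree \<open>d\<^sub>2\<close>.
\<close>

lemma catalecticant_minor_nonzero:
  fixes W :: "'k::field dpol set"
  assumes W: "pm.subspace W" "W \<subseteq> pol_deg_le {1..n} d\<^sub>1" and d: "d\<^sub>1 \<le> d\<^sub>2"
    and m: "m \<le> quot_dim (pol_vars {1..n}) (Ann n W)"
    and bs: "basis_list (homogenization n d\<^sub>1 d\<^sub>2 W) bs" "length bs = k"
  obtains P where "P \<in> catalecticant_minors n d\<^sub>1 d\<^sub>2 k m" "mpol_eval (plucker bs) P \<noteq> 0"
proof -
  obtain U where U: "finite U" "card U = quot_dim (pol_vars {1..n}) (Ann n W)"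
    "\<And>u. u \<in> U \<Longrightarrow> keys u \<subseteq> {1..n} \<and> mdeg u \<le> d\<^sub>1"
    "\<And>c. (\<Sum>u\<in>U. single u (c u)) \<in> Ann n W \<Longrightarrow> (\<forall>u\<in>U. c u = 0)"
    using monomial_basis_mod_Ann[OF W(2)] by metis
  obtain v where v: "inj_on v {..<m}" "v ` {..<m} \<subseteq> U"
    using card_le_inj[of "{..<m}" U] m U by auto
  define u where "u b = homogenize_expo d\<^sub>1 (v b)" for b
  have vU: "keys (v b) \<subseteq> {1..n}" "mdeg (v b) \<le> d\<^sub>1" if "b < m" for b
    using that v(2) U(3) by auto
  have u: "u b \<in> expos n d\<^sub>1" if "b < m" for b
    unfolding u_def by (rule homogenize_expo_in_expos) (use vU[OF that] in auto)
  \<comment> \<open>All available rows for the fixed columns \<open>u b\<close>, which homogenize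
    \<open>m\<close> monomials independent modulo \<open>Ann n W\<close>. A nonzero \<open>m\<close>
    by \<open>m\<close> minor exists once no nonzero \<open>c\<close> is orthogonal to all of
    them.\<close>
  define R where "R = {\<lambda>b. plucker bs (us[j := u b + w]) | us j w. length us = k \<and>
    set us \<subseteq> expos n (d\<^sub>1 + d\<^sub>2) \<and> j < k \<and> w \<in> expos n d\<^sub>2}"
  have "\<exists>\<rho>\<in>R. (\<Sum>b<m. \<rho> b * c b) \<noteq> 0" if c: "\<exists>b<m. c b \<noteq> 0" for c
  proof -
    define \<theta> where "\<theta> = (\<Sum>b<m. single (v b) (c b))"
    have "\<theta> \<notin> Ann n W"
    proof
      assume \<theta>: "\<theta> \<in> Ann n W"
      \<comment> \<open>The coefficients \<open>c\<close> transported along \<open>v\<close> and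
        extended by zero to all of \<open>U\<close>.\<close>
      define c' where "c' x = (if x \<in> v ` {..<m} then c (the_inv_into {..<m} v x) else 0)" for x
      have "(\<Sum>x\<in>U. single x (c' x)) = (\<Sum>x\<in>v ` {..<m}. single x (c' x))"
        using v(2) U(1) by (intro sum.mono_neutral_right) (auto simp: c'_def)
      also have "\<dots> = \<theta>"
        unfolding sum.reindex[OF v(1)] \<theta>_def
        by (rule sum.cong) (auto simp: c'_def the_inv_into_f_f[OF v(1)])
      finally have "\<forall>x\<in>U. c' x = 0" using U(4) \<theta> by simp
      hence "c b = 0" if "b < m" for b
        using that v(2) by (force simp: c'_def the_inv_into_f_f[OF v(1)])
      thus False using c by blast
    qed
    moreover have "\<theta> \<in> pol_vars {1..n}"
      unfolding \<theta>_def using vU by (intro pm.subspace_sum[OF subspace_pol_vars]) (auto simp: pol_vars_def)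
    ultimately obtain F w where F: "F \<in> W" and w: "pairing \<theta> (\<lambda>u. lookup F (u + w)) \<noteq> 0"
      by (auto simp: Ann_iff)
    have F': "F \<in> pol_deg_le {1..n} d\<^sub>1" using F W(2) by auto
    have nz: "(\<Sum>b<m. c b * lookup F (v b + w)) \<noteq> 0"
      using w by (simp add: \<theta>_def pairing_sum)
    \<comment> \<open>A nonzero term shows that \<open>v b + w\<close> occurs in \<open>F\<close>.
      This is what confines \<open>w\<close> to the variables of \<open>S\<close> and to degree at
      most \<open>d\<^sub>1\<close>.\<close>
    then obtain b where "b < m" "lookup F (v b + w) \<noteq> 0"
      by (metis (no_types, lifting) lessThan_iff mult_zero_right sum.neutral)
    hence "v b + w \<in> keys F" by (simp add: in_keys_iff)
    hence w': "keys w \<subseteq> {1..n}" "mdeg w \<le> d\<^sub>2"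
      using pol_deg_leD[OF F', of "v b + w"] d by (auto simp: keys_add_expo mdeg_add)
    have w0: "0 \<notin> keys w" using w'(1) by auto
    define w2 where "w2 = homogenize_expo d\<^sub>2 w"
    have w2: "w2 \<in> expos n d\<^sub>2"
      unfolding w2_def by (rule homogenize_expo_in_expos[OF w'])
    define G where "G = homogenize (d\<^sub>1 + d\<^sub>2) F"
    have GV: "G \<in> pm.span (set bs)"
      using bs(1) F unfolding basis_list_def homogenization_eq_image[OF W(2)] G_def by auto
    \<comment> \<open>The two homogenized exponents add up to degree
      \<open>d\<^sub>1 + d\<^sub>2\<close>, and \<open>bar\<close> undoes both homogenizations, so
      the coefficient is that of \<open>F\<close> itself.\<close>
    have "lookup G (u b + w2) = lookup F (v b + w)" if b: "b < m" for b
    proof -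
      have "mdeg (u b + w2) = d\<^sub>1 + d\<^sub>2"
        using expos_add[OF u[OF b] w2] by (simp add: expos_def)
      moreover have "0 \<notin> keys (v b)" using vU(1)[OF b] by auto
      hence "bar (u b + w2) = v b + w"
        by (simp add: u_def w2_def bar_add bar_homogenize_expo w0)
      ultimately show ?thesis
        unfolding G_def by (subst lookup_homogenize[OF F']) auto
    qed
    hence sum_G: "(\<Sum>b<m. c b * lookup G (u b + w2)) \<noteq> 0" using nz by simp
    have deg: "set bs \<subseteq> pol_deg {0..n} (d\<^sub>1 + d\<^sub>2)"
      using bs(1) homogenization_in_Gr[OF W, of d\<^sub>2] pm.span_superset[of "set bs"]
      by (auto simp: basis_list_def Gr_def)
    have ind: "distinct bs" "pm.independent (set bs)" using bs(1) by (auto simp: basis_list_def)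
    obtain us j where "length us = length bs" "set us \<subseteq> expos n (d\<^sub>1 + d\<^sub>2)" "j < length bs"
      "(\<Sum>b<m. c b * plucker bs (us[j := u b + w2])) \<noteq> 0"
      by (rule plucker_detects_functional[OF ind deg GV sum_G])
    thus ?thesis
      using w2 bs(2)
      by (intro bexI[of _ "\<lambda>b. plucker bs (us[j := u b + w2])"]) (auto simp: R_def mult.commute)
  qed
  from exists_nonzero_minor[OF this] obtain \<rho> where
    \<rho>: "\<And>a. a < m \<Longrightarrow> \<rho> a \<in> R" "det (mat m m (\<lambda>(a, b). \<rho> a b)) \<noteq> 0" by blast
  have "\<forall>a. \<exists>us j w. a < m \<longrightarrow> \<rho> a = (\<lambda>b. plucker bs (us[j := u b + w])) \<and> length us = k \<and>
    set us \<subseteq> expos n (d\<^sub>1 + d\<^sub>2) \<and> j < k \<and> w \<in> expos n d\<^sub>2"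
    using \<rho>(1) unfolding R_def by blast
  then obtain us j w where *: "\<And>a. a < m \<Longrightarrow> \<rho> a = (\<lambda>b. plucker bs ((us a)[j a := u b + w a])) \<and>
    length (us a) = k \<and> set (us a) \<subseteq> expos n (d\<^sub>1 + d\<^sub>2) \<and> j a < k \<and> w a \<in> expos n d\<^sub>2"
    by metis
  let ?P = "det_form m (\<lambda>a b. (us a)[j a := u b + w a]) :: (nat expo list, 'k) mpol"
  have "?P \<in> catalecticant_minors n d\<^sub>1 d\<^sub>2 k m"
    unfolding catalecticant_minors_def using * u by blast
  moreover have "mat m m (\<lambda>(a, b). \<rho> a b) = mat m m (\<lambda>(a, b). plucker bs ((us a)[j a := u b + w a]))"
    by (rule eq_matI) (auto simp: *)
  hence "mpol_eval (plucker bs) ?P \<noteq> 0"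
    using \<rho>(2) by (simp add: mpol_eval_det_form)
  ultimately show ?thesis using that by blast
qed

text \<open>The common zero locus \<open>Z\<close> of the minors of size \<open>s + 1\<close> is
  closed and contains every subspace of cactus rank at most \<open>s\<close>, hence the cactus
  variety. If \<open>r\<close> exceeded \<open>s\<close>, the homogenization would have a nonzero
  minor of that size.\<close>

lemma homogenization_in_cactus_variety_imp_le:
  fixes W :: "'k::field dpol set"
  assumes W: "pm.subspace W" "W \<subseteq> pol_deg_le {1..n} d\<^sub>1" and d: "d\<^sub>1 \<le> d\<^sub>2"
    and s: "homogenization n d\<^sub>1 d\<^sub>2 W \<in> cactus_variety n (d\<^sub>1 + d\<^sub>2) s (pm.dim (homogenization n d\<^sub>1 d\<^sub>2 W))"
  shows "quot_dim (pol_vars {1..n}) (Ann n W) \<le> s"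
proof (rule ccontr)
  assume "\<not> ?thesis"
  hence m: "Suc s \<le> quot_dim (pol_vars {1..n}) (Ann n W)" by simp
  let ?V = "homogenization n d\<^sub>1 d\<^sub>2 W" and ?d = "d\<^sub>1 + d\<^sub>2"
  let ?k = "pm.dim ?V"
  let ?P = "catalecticant_minors n d\<^sub>1 d\<^sub>2 ?k (Suc s) :: (nat expo list, 'k) mpol set"
  define Z where "Z = {V \<in> Gr n ?d ?k. \<forall>P\<in>?P. \<forall>bs. basis_list V bs \<longrightarrow> mpol_eval (plucker bs) P = 0}"
  have "Gr_closed n ?d ?k Z"
    unfolding Gr_closed_def Z_def by (intro exI[of _ ?P] conjI catalecticant_minors_subset refl)
  moreover have "{V \<in> Gr n ?d ?k. cactus_rank n ?d V \<le> enat s} \<subseteq> Z"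
  proof
    fix V :: "'k dpol set" assume "V \<in> {V \<in> Gr n ?d ?k. cactus_rank n ?d V \<le> enat s}"
    hence "V \<in> Gr n ?d ?k" "cactus_rank n ?d V \<le> enat s" by auto
    thus "V \<in> Z" unfolding Z_def by (auto intro: catalecticant_minors_vanish)
  qed
  ultimately have VZ: "?V \<in> Z"
    using s unfolding cactus_variety_def Gr_closure_def by blast
  obtain bs where bs: "basis_list ?V bs" "length bs = ?k"
    using homogenization_in_Gr[OF W, of d\<^sub>2] basis_list_exists[of ?V n ?d] by (auto simp: Gr_def)
  obtain P where "P \<in> ?P" "mpol_eval (plucker bs) P \<noteq> 0"
    using catalecticant_minor_nonzero[OF W d m bs] by blast
  with VZ bs(1) show False unfolding Z_def by blast
qed

lemma in_cactus_variety:
  assumes "V \<in> Gr n d k" "cactus_rank n d V \<le> enat s"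
  shows "V \<in> cactus_variety n d s k"
  using assms unfolding cactus_variety_def Gr_closure_def by blast

lemma border_cactus_rank_le_cactus_rank:
  assumes V: "V \<in> Gr n d (pm.dim V)"
  shows "border_cactus_rank n d V \<le> cactus_rank n d V"
  unfolding cactus_rank_def
proof (rule Inf_greatest)
  fix x assume "x \<in> {enat r | r. r > 0 \<and> (\<exists>I. zero_dim_subscheme n r I \<and> V \<subseteq> veronese_span n d I)}"
  then obtain r where r: "x = enat r" "r > 0" "\<exists>I. zero_dim_subscheme n r I \<and> V \<subseteq> veronese_span n d I"
    by blast
  have "cactus_rank n d V \<le> enat r"
    unfolding cactus_rank_def using r by (intro Inf_lower) blast
  hence "V \<in> cactus_variety n d r (pm.dim V)" by (rule in_cactus_variety[OF V])
  thus "border_cactus_rank n d V \<le> x"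
    unfolding border_cactus_rank_def r(1) using r(2) by (intro Inf_lower) blast
qed

theorem theorem1p9:
  fixes W :: "'k::alg_closed_field dpol set" and n d\<^sub>1 d\<^sub>2 r :: nat
  assumes "n \<ge> 1" and "d\<^sub>1 \<ge> 1"
    and "pm.subspace W" and "W \<subseteq> pol_deg_le {1..n} d\<^sub>1" and "W \<noteq> {0}"
    and "r = quot_dim (pol_vars {1..n}) (Ann n W)"
  shows "cactus_rank n (d\<^sub>1 + d\<^sub>2) (homogenization n d\<^sub>1 d\<^sub>2 W) \<le> enat r \<and>
    (d\<^sub>2 \<ge> d\<^sub>1 \<longrightarrow>
      border_cactus_rank n (d\<^sub>1 + d\<^sub>2) (homogenization n d\<^sub>1 d\<^sub>2 W) = enat r \<and>
      cactus_rank n (d\<^sub>1 + d\<^sub>2) (homogenization n d\<^sub>1 d\<^sub>2 W) =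
        border_cactus_rank n (d\<^sub>1 + d\<^sub>2) (homogenization n d\<^sub>1 d\<^sub>2 W))"
proof (intro conjI impI)
  let ?V = "homogenization n d\<^sub>1 d\<^sub>2 W" and ?d = "d\<^sub>1 + d\<^sub>2"
  show cactus_le: "cactus_rank n ?d ?V \<le> enat r"
    unfolding assms(6) by (rule cactus_rank_homogenization_le[OF assms(4,3,5)])
  have border_le: "border_cactus_rank n ?d ?V \<le> cactus_rank n ?d ?V"
    by (rule border_cactus_rank_le_cactus_rank[OF homogenization_in_Gr[OF assms(3,4)]])
  assume d: "d\<^sub>1 \<le> d\<^sub>2"
  \<comment> \<open>This closes the chain: \<open>r\<close> is at most the border cactus rank, which
    is at most the cactus rank, which is at most \<open>r\<close>.\<close>
  have "enat r \<le> border_cactus_rank n ?d ?V"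
    unfolding border_cactus_rank_def assms(6)
    by (rule Inf_greatest) (use homogenization_in_cactus_variety_imp_le[OF assms(3,4) d] in auto)
  with cactus_le border_le
  show "border_cactus_rank n ?d ?V = enat r" "cactus_rank n ?d ?V = border_cactus_rank n ?d ?V"
    by auto
qed

end
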